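(* Let $R$ be a finitely generated ring and let $n\geq 2$ be an integer. Let $\Gamma$ be one of the following groups: the elementary group $E_{k+1}(R)$ for some integer $k\geq n$; or the unitary elementary group $EU_{2k}(R,\Lambda)$ for some form ring $(R,\Lambda)$ over $R$ and some integer $k\geq\max\{n,3\}$, where $EU_{2k}(R,\Lambda)$ is assumed to be finitely generated. Then: (i) for any field $K$ and any representation $\rho:\Gamma\to\mathrm{GL}_n(K)$ of degree $n$ over $K$, the eigenvalues of each of the matrices in $\rho(\Gamma)$ are integral; in particular they are algebraic integers if $\mathrm{char}(K)=0$ and are roots of unity if $\mathrm{char}(K)>0$; (ii) for any algebraically closed field $K$, there are only finitely many conjugacy classes of irreducible representations of $\Gamma$ into $\mathrm{GL}_n(K)$.
   Context: All rings are associative with identity, not necessarily commutative. Eigenvalues are taken in an algebraic closure of $K$, and "integral" means integral over $\mathbb{Z}$ (over the image of $\mathbb Z$ in $K$). Elementary group. $E_m(R)\leq\mathrm{GL}_m(R)$ is generated by all $e_{ij}(r)$ ($1$ on the diagonal, $r\in R$ in position $(i,j)$, $i\neq j$, $0$ elsewhere). Form ring. Let $*:x\mapsto x^*$ be an anti-automorphism of $R$ such that $x^{**}=\varepsilon x\varepsilon^*$ for all $x\in R$, for some unit $\varepsilon\in R$ with $\varepsilon^*=\varepsilon^{-1}$. Put $R_\varepsilon=\{x-x^*\varepsilon: x\in R\}$ and $R^\varepsilon=\{x\in R: x=-x^*\varepsilon\}$. A form is an additive subgroup $\Lambda$ of $R$ with $r^*\Lambda r\subset\Lambda$ for all $r\in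 R$ and $R_\varepsilon\subset\Lambda\subset R^\varepsilon$. Then $(R,\Lambda)$ is called a form ring. Unitary elementary group. Fix $k$; for $1\leq l\leq 2k$ put $\sigma l=l+k$ if $l\leq k$ and $\sigma l=l-k$ if $l>k$. Let $E_{ij}$ be the $2k\times 2k$ matrix unit. The elementary unitary matrices are: $\rho_{i,\sigma i}(a)=I_{2k}+aE_{i,\sigma i}$, where $a\in\Lambda$ if $i\geq k+1$ and $a^*\in\Lambda$ if $i\leq k$; and, for $i\neq j$, $j\neq\sigma i$, $a\in R$, $\rho_{ij}(a)=I_{2k}+aE_{ij}-a'E_{\sigma j,\sigma i}$, where $a'=a^*$ if $i,j\leq k$; $a'=\varepsilon^*a^*$ if $i\leq k<j$; $a'=a^*\varepsilon$ if $j\leq k<i$; $a'=\varepsilon^*a^*\varepsilon$ if $i,j\geq k+1$. $EU_{2k}(R,\Lambda)\leq\mathrm{GL}_{2k}(R)$ is the subgroup generated by them. *)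

theory Defs
  imports
    "Jordan_Normal_Form.VS_Connect"
    "Jordan_Normal_Form.Char_Poly"
    "HOL-Algebra.Generated_Groups"
    "HOL-Algebra.Generated_Rings"
    "HOL-Algebra.Algebraic_Closure_Type"
begin

hide_const (open) Multiset.mult

text \<open>
  Associative rings with identity are types of sort \<open>{ring, monoid_mult}\<close>; unlike \<open>ring_1\<close>, this
  sort does not exclude the zero ring. The library's \<open>ring_mat\<close> needs \<open>semiring_1\<close>, so the matrix
  monoid is restated here. Matrix and vector indices start at 0.
\<close>

definition mat_mult_monoid :: "nat \<Rightarrow> 'a :: {semiring_0, monoid_mult} mat monoid" where
  "mat_mult_monoid m = \<lparr> carrier = carrier_mat m m, mult = (*), one = 1\<^sub>m m \<rparr>"

definition GL :: "nat \<Rightarrow> 'a :: {semiring_0, monoid_mult} mat monoid" where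
  "GL m = units_of (mat_mult_monoid m)"

definition fin_gen_ring :: "'r :: {ring, monoid_mult} itself \<Rightarrow> bool" where
  "fin_gen_ring _ \<longleftrightarrow>
     (\<exists>S :: 'r set. finite S \<and> generate_ring (class_ring :: 'r ring) S = UNIV)"

definition fin_gen_group :: "('g, 'b) monoid_scheme \<Rightarrow> bool" where
  "fin_gen_group G \<longleftrightarrow> (\<exists>S. finite S \<and> S \<subseteq> carrier G \<and> generate G S = carrier G)"


definition mat_unit :: "nat \<Rightarrow> nat \<Rightarrow> nat \<Rightarrow> 'a :: zero \<Rightarrow> 'a mat" where
  "mat_unit m i j a = mat m m (\<lambda>p. if p = (i, j) then a else 0)"

text \<open>
  All generators of the groups below have the form \<open>1\<^sub>m m + N\<close> with \<open>N * N = 0\<close>, hence lie in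
  \<open>GL m\<close>; the intersection with the carrier inside \<open>subgroup_generated\<close> removes nothing.
\<close>

definition elementary_mat :: "nat \<Rightarrow> nat \<Rightarrow> nat \<Rightarrow> 'r \<Rightarrow> 'r :: {ring, monoid_mult} mat" where
  "elementary_mat m i j r = 1\<^sub>m m + mat_unit m i j r"

definition elementary_group :: "nat \<Rightarrow> 'r :: {ring, monoid_mult} mat monoid" where
  "elementary_group m =
     subgroup_generated (GL m) {elementary_mat m i j r | i j r. i < m \<and> j < m \<and> i \<noteq> j}"


text \<open>The pair \<open>(R, \<Lambda>)\<close> is relative to a choice of \<open>star\<close> and \<open>eps\<close>. The equation \<open>star 1 = 1\<close> follows from \<open>star_bij\<close> and \<open>star_mult\<close>.\<close>

locale form_ring =
  fixes star :: "'r :: {ring, monoid_mult} \<Rightarrow> 'r" and eps :: 'r and Lam :: "'r set"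
  assumes star_bij: "bij star"
    and star_add: "star (x + y) = star x + star y"
    and star_mult: "star (x * y) = star y * star x"
    and eps_unit: "eps * star eps = 1" "star eps * eps = 1"
    and star_star: "star (star x) = eps * x * star eps"
    and Lam_zero: "0 \<in> Lam"
    and Lam_add: "x \<in> Lam \<Longrightarrow> y \<in> Lam \<Longrightarrow> x + y \<in> Lam"
    and Lam_uminus: "x \<in> Lam \<Longrightarrow> - x \<in> Lam"
    and Lam_conj: "x \<in> Lam \<Longrightarrow> star r * x * r \<in> Lam"
    and Lam_lower: "{x - star x * eps | x. True} \<subseteq> Lam"
    and Lam_upper: "Lam \<subseteq> {x. x = - (star x * eps)}"

definition sig :: "nat \<Rightarrow> nat \<Rightarrow> nat" where
  "sig k l = (if l < k then l + k else l - k)"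

definition eu_short :: "nat \<Rightarrow> nat \<Rightarrow> 'r \<Rightarrow> 'r :: {ring, monoid_mult} mat" where
  "eu_short k i a = 1\<^sub>m (2 * k) + mat_unit (2 * k) i (sig k i) a"

definition eu_prime ::
    "('r :: {ring, monoid_mult} \<Rightarrow> 'r) \<Rightarrow> 'r \<Rightarrow> nat \<Rightarrow> nat \<Rightarrow> nat \<Rightarrow> 'r \<Rightarrow> 'r" where
  "eu_prime star eps k i j a =
     (if i < k \<and> j < k then star a
      else if i < k \<and> k \<le> j then star eps * star a
      else if j < k \<and> k \<le> i then star a * eps
      else star eps * star a * eps)"

definition eu_long ::
    "('r :: {ring, monoid_mult} \<Rightarrow> 'r) \<Rightarrow> 'r \<Rightarrow> nat \<Rightarrow> nat \<Rightarrow> nat \<Rightarrow> 'r \<Rightarrow> 'r mat" where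
  "eu_long star eps k i j a =
     1\<^sub>m (2 * k) + mat_unit (2 * k) i j a
       - mat_unit (2 * k) (sig k j) (sig k i) (eu_prime star eps k i j a)"

definition unitary_elementary_group ::
    "('r :: {ring, monoid_mult} \<Rightarrow> 'r) \<Rightarrow> 'r \<Rightarrow> 'r set \<Rightarrow> nat \<Rightarrow> 'r mat monoid" where
  "unitary_elementary_group star eps Lam k =
     subgroup_generated (GL (2 * k))
       ({eu_short k i a | i a. k \<le> i \<and> i < 2 * k \<and> a \<in> Lam}
        \<union> {eu_short k i a | i a. i < k \<and> star a \<in> Lam}
        \<union> {eu_long star eps k i j a | i j a. i < 2 * k \<and> j < 2 * k \<and> i \<noteq> j \<and> j \<noteq> sig k i})"


definition reps :: "('g, 'b) monoid_scheme \<Rightarrow> nat \<Rightarrow> ('g \<Rightarrow> 'k :: field mat) set" where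
  "reps G n = hom G (GL n)"

definition irreducible_rep ::
    "('g, 'b) monoid_scheme \<Rightarrow> nat \<Rightarrow> ('g \<Rightarrow> 'k :: field mat) \<Rightarrow> bool" where
  "irreducible_rep G n \<rho> \<longleftrightarrow>
     \<rho> \<in> reps G n \<and> n > 0 \<and>
     (\<forall>W. VectorSpace.subspace class_ring W (module_vec TYPE('k) n) \<and>
          (\<forall>g \<in> carrier G. \<forall>w \<in> W. \<rho> g *\<^sub>v w \<in> W) \<longrightarrow>
          W = {0\<^sub>v n} \<or> W = carrier_vec n)"

text \<open>
  Two homomorphisms that agree on \<open>carrier G\<close> but differ elsewhere are the same representation;
  the relation identifies them, so its classes are the conjugacy classes.
\<close>

definition conj_irreducible_reps ::
    "('g, 'b) monoid_scheme \<Rightarrow> nat \<Rightarrow> (('g \<Rightarrow> 'k :: field mat) \<times> ('g \<Rightarrow> 'k mat)) set" where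
  "conj_irreducible_reps G n =
     {(\<rho>, \<rho>'). irreducible_rep G n \<rho> \<and> irreducible_rep G n \<rho>' \<and>
        (\<exists>P \<in> carrier (GL n). \<forall>g \<in> carrier G. \<rho>' g = P * \<rho> g * inv\<^bsub>GL n\<^esub> P)}"

end

theory Submission
  imports Defs "HOL-Library.Function_Algebras"
begin

text \<open>
  The reason behind the theorem is that every representation of \<open>\<Gamma>\<close> of degree \<open>n\<close> is trivial. The
  eigenvalues in question are then all equal to 1, and since \<open>n \<ge> 2\<close> there is no irreducible
  representation at all. Composing with the embedding into an algebraic closure, one may assume that
  \<open>K\<close> is algebraically closed. Let \<open>V = K\<^sup>n\<close>.

  \<^emph>\<open>Root elements have no eigenvalue other than 1.\<close> In \<open>E\<^sub>m(R)\<close> the matrices \<open>e\<^sub>i\<^sub>j(1)\<close>, \<open>j \<noteq> i\<close>, of one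
  row commute. Let \<open>v\<close> be a joint eigenvector, with eigenvalues \<open>\<lambda>\<^sub>j\<close>. Conjugation by \<open>e\<^sub>b\<^sub>a(1)\<close> turns
  \<open>e\<^sub>i\<^sub>b(1)\<close> into \<open>e\<^sub>i\<^sub>b(1) e\<^sub>i\<^sub>a(1)\<close> and fixes the other members of the row, so \<open>e\<^sub>b\<^sub>a(1) v\<close> is again a
  joint eigenvector, with \<open>\<lambda>\<^sub>b\<close> replaced by \<open>\<lambda>\<^sub>b \<lambda>\<^sub>a\<close>. If some \<open>\<lambda>\<^sub>a\<close> differs from 1, then such moves
  reach a vector for which all \<open>\<lambda>\<^sub>j\<close> differ from 1 (\<open>shear_eigenvectors\<close>). From there, one move for each
  \<open>b\<close> changes the coordinate \<open>b\<close> alone. Together with the vector itself this gives \<open>m\<close> different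
  systems of eigenvalues. Their eigenvectors are linearly independent, which is impossible for
  \<open>n < m\<close> (\<open>elementary_unipotent\<close>).

  \<^emph>\<open>A long commutator acts trivially.\<close> By Kolchin's argument, the group generated by the upper
  triangular \<open>e\<^sub>i\<^sub>j(1)\<close> has a flag \<open>0 = V\<^sub>0 \<subseteq> V\<^sub>1 \<subseteq> \<dots>\<close> that reaches \<open>V\<close> after at most \<open>n\<close> steps and on
  whose successive quotients the group acts trivially (\<open>flag_exhausts\<close>). If \<open>g - 1\<close> lowers the flag by
  \<open>p\<close> steps and \<open>h - 1\<close> by \<open>q\<close>, then \<open>[g, h] - 1\<close> lowers it by \<open>p + q\<close> (\<open>lowers_commutator\<close>). The
  element \<open>e\<^sub>0\<^sub>,\<^sub>m\<^sub>-\<^sub>1(1)\<close> is a commutator of \<open>m - 1 \<ge> n\<close> of the generators, so it acts trivially. The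
  commutator relations spread triviality from this one element to all root elements
  (\<open>root_elements_in_kernel\<close>).

  \<^emph>\<open>The unitary group.\<close> Here \<open>n \<le> k\<close>, so in both steps one more dimension has to be excluded than for
  \<open>E\<^sub>k(R)\<close> inside \<open>EU\<^sub>2\<^sub>k(R, \<Lambda>)\<close>. The commuting family is now a row of long root elements
  \<open>\<rho>\<^sub>i\<^sub>,\<^sub>\<sigma>\<^sub>l(1)\<close>. The further eigenvector comes from another such element \<open>\<rho>\<^sub>a\<^sub>,\<^sub>\<sigma>\<^sub>b(1)\<close>, which commutes with
  that row but changes an eigenvalue of \<open>\<rho>\<^sub>i\<^sub>a(1)\<close> (\<open>up_unipotent\<close>). In the second step the chain of
  commutators climbs from \<open>\<rho>\<^sub>k\<^sub>-\<^sub>2\<^sub>,\<^sub>\<sigma>\<^sub>(\<^sub>k\<^sub>-\<^sub>1\<^sub>)(1)\<close> up to \<open>\<rho>\<^sub>0\<^sub>,\<^sub>\<sigma>\<^sub>(\<^sub>k\<^sub>-\<^sub>1\<^sub>)(1)\<close> and from there to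
  \<open>\<rho>\<^sub>0\<^sub>,\<^sub>\<sigma>\<^sub>(\<^sub>k\<^sub>-\<^sub>2\<^sub>)(1)\<close>, which lowers the flag by \<open>k\<close> steps (\<open>up_in_kernel\<close>). The short root elements follow from the long
  ones by one more commutator relation.
\<close>

section \<open>Operators on a finite-dimensional space over an algebraically closed field\<close>

text \<open>
  The space is a subspace \<open>V\<close> of an ambient type, because \<open>K\<^sup>n\<close> with \<open>n\<close> a term is not a type.
\<close>
locale bounded_space = vector_space scale
  for scale :: "'k :: alg_closed_field \<Rightarrow> 'v :: ab_group_add \<Rightarrow> 'v" (infixr "*s" 75) +
  fixes V :: "'v set" and n :: nat
  assumes subspace_V: "subspace V"
    and V_spanned: "\<exists>B. finite B \<and> card B \<le> n \<and> V \<subseteq> span B"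
begin

lemma zero_V [simp]: "0 \<in> V"
  and add_V [simp]: "v \<in> V \<Longrightarrow> w \<in> V \<Longrightarrow> v + w \<in> V"
  and diff_V [simp]: "v \<in> V \<Longrightarrow> w \<in> V \<Longrightarrow> v - w \<in> V"
  and scale_V [simp]: "v \<in> V \<Longrightarrow> c *s v \<in> V"
  using subspace_V by (auto simp: subspace_0 subspace_add subspace_diff subspace_scale)

text \<open>
  Independence of an indexed family: two equal members would already violate it, so the family is
  injective and the usual bound for independent sets applies.
\<close>
lemma independent_family_card_le:
  assumes "finite I" and "\<And>i. i \<in> I \<Longrightarrow> u i \<in> V"
    and indep: "\<And>c i. (\<Sum>i\<in>I. c i *s u i) = 0 \<Longrightarrow> i \<in> I \<Longrightarrow> c i = 0"
  shows "card I \<le> n"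
proof -
  have inj: "inj_on u I"
  proof (rule inj_onI, rule ccontr)
    fix i j assume ij: "i \<in> I" "j \<in> I" "u i = u j" "i \<noteq> j"
    define c :: "_ \<Rightarrow> 'k" where "c = (\<lambda>x. if x = i then 1 else if x = j then - 1 else 0)"
    have "(\<Sum>x\<in>I. c x *s u x) = (\<Sum>x\<in>{i, j}. c x *s u x)"
      using ij assms(1) by (intro sum.mono_neutral_right) (auto simp: c_def)
    also have "\<dots> = 0" using ij by (simp add: c_def)
    finally have "c i = 0" using indep ij by blast
    then show False by (simp add: c_def)
  qed
  have "independent (u ` I)"
  proof (rule independent_if_scalars_zero)
    fix f x assume "(\<Sum>x\<in>u ` I. f x *s x) = 0" "x \<in> u ` I"
    then show "f x = 0"
      using indep[of "\<lambda>i. f (u i)"] by (auto simp: sum.reindex[OF inj])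
  qed (use assms in auto)
  moreover obtain B where "finite B" "card B \<le> n" "V \<subseteq> span B" using V_spanned by blast
  ultimately have "card (u ` I) \<le> card B"
    using independent_span_bound[of B "u ` I"] assms(2) by blast
  then show ?thesis using card_image[OF inj] \<open>card B \<le> n\<close> by simp
qed

text \<open>
  Linearity is demanded on the whole ambient type, so that no membership conditions are needed to
  move an operator through a sum.
\<close>
definition operator :: "('v \<Rightarrow> 'v) \<Rightarrow> bool" where
  "operator A \<longleftrightarrow> (\<forall>v w. A (v + w) = A v + A w) \<and> (\<forall>c v. A (c *s v) = c *s A v) \<and> (\<forall>v\<in>V. A v \<in> V)"

lemma operator_V [simp]: "operator A \<Longrightarrow> v \<in> V \<Longrightarrow> A v \<in> V"
  by (simp add: operator_def)

lemma operator_add: "operator A \<Longrightarrow> A (v + w) = A v + A w"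
  and operator_scale: "operator A \<Longrightarrow> A (c *s v) = c *s A v"
  by (auto simp: operator_def)

lemma operator_zero [simp]: "operator A \<Longrightarrow> A 0 = 0"
  using operator_scale[of A 0 0] by simp

lemma operator_diff: "operator A \<Longrightarrow> A (v - w) = A v - A w"
  using operator_add[of A "v - w" w] by (simp add: algebra_simps)

lemma operator_sum: "operator A \<Longrightarrow> A (\<Sum>i\<in>I. f i) = (\<Sum>i\<in>I. A (f i))"
  by (induction I rule: infinite_finite_induct) (auto simp: operator_add)

text \<open>The vector \<open>p(A) v\<close>.\<close>
definition poly_op :: "('v \<Rightarrow> 'v) \<Rightarrow> 'k poly \<Rightarrow> 'v \<Rightarrow> 'v" where
  "poly_op A p v = (\<Sum>i\<le>Polynomial.degree p. Polynomial.coeff p i *s (A ^^ i) v)"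

lemma poly_op_altdef:
  assumes "Polynomial.degree p \<le> d"
  shows "poly_op A p v = (\<Sum>i\<le>d. Polynomial.coeff p i *s (A ^^ i) v)"
  unfolding poly_op_def using assms
  by (intro sum.mono_neutral_left) (auto simp: coeff_eq_0)

lemma poly_op_in:
  assumes "subspace W" "\<And>w. w \<in> W \<Longrightarrow> A w \<in> W" "v \<in> W"
  shows "poly_op A p v \<in> W"
proof -
  have "(A ^^ i) v \<in> W" for i by (induction i) (use assms in auto)
  then show ?thesis unfolding poly_op_def
    by (intro subspace_sum subspace_scale assms)
qed

lemma poly_op_linear_factor:
  assumes A: "operator A"
  shows "poly_op A ([:- c, 1:] * q) v = A (poly_op A q v) - c *s poly_op A q v"
proof -
  define d where "d = Polynomial.degree q"
  have pow: "A ((A ^^ i) v) = (A ^^ Suc i) v" for i by simp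
  have "poly_op A (pCons 0 q) v = (\<Sum>i\<le>Suc d. Polynomial.coeff (pCons 0 q) i *s (A ^^ i) v)"
    by (rule poly_op_altdef) (simp add: d_def degree_pCons_le)
  also have "\<dots> = A (poly_op A q v)"
    unfolding sum.atMost_Suc_shift
    by (simp add: poly_op_def d_def operator_sum[OF A] operator_scale[OF A])
  finally have 1: "poly_op A (pCons 0 q) v = A (poly_op A q v)" .
  have 2: "poly_op A (Polynomial.smult c q) v = c *s poly_op A q v"
    by (subst poly_op_altdef[of _ d]) (auto simp: d_def poly_op_def scale_sum_right degree_smult_le)
  have e: "[:- c, 1:] * q = pCons 0 q - Polynomial.smult c q" by (simp add: mult_pCons_left)
  have deg: "Polynomial.degree (pCons 0 q) \<le> Suc d" "Polynomial.degree (Polynomial.smult c q) \<le> Suc d"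
    by (auto simp: d_def degree_pCons_le)
  then have "Polynomial.degree (pCons 0 q - Polynomial.smult c q) \<le> Suc d"
    by (intro degree_diff_le)
  note deg = deg this
  have "poly_op A ([:- c, 1:] * q) v = poly_op A (pCons 0 q) v - poly_op A (Polynomial.smult c q) v"
    unfolding e
    using poly_op_altdef[of "pCons 0 q" "Suc d"] poly_op_altdef[of "Polynomial.smult c q" "Suc d"]
      poly_op_altdef[of "pCons 0 q - Polynomial.smult c q" "Suc d"] deg
    by (simp only: coeff_diff scale_left_diff_distrib sum_subtractf)
  then show ?thesis using 1 2 by simp
qed

lemma poly_op_commute:
  assumes "operator A" "operator B" "\<And>v. v \<in> V \<Longrightarrow> A (B v) = B (A v)" "v \<in> V"
  shows "poly_op A p (B v) = B (poly_op A p v)"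
proof -
  have inV: "(A ^^ i) v \<in> V" for i by (induction i) (use assms in auto)
  have "(A ^^ i) (B v) = B ((A ^^ i) v)" for i
    by (induction i) (use assms inV in auto)
  then show ?thesis using assms by (simp add: poly_op_def operator_sum operator_scale)
qed

lemma annihilating_poly_exists:
  assumes A: "operator A" and v: "v \<in> V"
  shows "\<exists>p. p \<noteq> 0 \<and> poly_op A p v = 0"
proof -
  have inV: "(A ^^ i) v \<in> V" for i by (induction i) (use assms in auto)
  have "\<not> card {..n} \<le> n" by simp
  then obtain c i where c: "(\<Sum>i\<le>n. c i *s (A ^^ i) v) = 0" "i \<le> n" "c i \<noteq> 0"
    using independent_family_card_le[of "{..n}" "\<lambda>i. (A ^^ i) v"] inV by blast
  define p where "p = (\<Sum>i\<le>n. Polynomial.monom (c i) i)"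
  have coeff: "Polynomial.coeff p j = (if j \<le> n then c j else 0)" for j
    by (simp add: p_def coeff_sum)
  then have "p \<noteq> 0" using c by (metis coeff_0)
  moreover have "Polynomial.degree p \<le> n" by (intro degree_le) (simp add: coeff)
  then have "poly_op A p v = 0"
    using c by (simp add: poly_op_altdef[of p n] coeff)
  ultimately show ?thesis by blast
qed

text \<open>
  Divide an annihilating polynomial of \<open>v\<close> by one linear factor \<open>x - c\<close> after the other. At the last
  moment before the result vanishes, it is an eigenvector for the eigenvalue \<open>c\<close>, and it has not left
  the invariant subspace.
\<close>
lemma eigenvector_exists:
  assumes A: "operator A" and W: "subspace W" "W \<subseteq> V" "\<And>w. w \<in> W \<Longrightarrow> A w \<in> W"
    and v: "v \<in> W" "v \<noteq> 0"
  shows "\<exists>w c. w \<in> W \<and> w \<noteq> 0 \<and> A w = c *s w"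
proof -
  obtain p where "p \<noteq> 0" "poly_op A p v = 0" using annihilating_poly_exists A W v by blast
  then show ?thesis
  proof (induction "Polynomial.degree p" arbitrary: p)
    case 0
    then obtain c where "p = [:c:]" by (metis degree_eq_zeroE)
    with 0 v show ?case by (simp add: poly_op_def)
  next
    case (Suc d)
    obtain c where "poly p c = 0" using alg_closed_imp_poly_has_root[of p] Suc by auto
    then obtain q where q: "p = [:- c, 1:] * q" using poly_eq_0_iff_dvd by (auto simp: dvd_def)
    show ?case
    proof (cases "poly_op A q v = 0")
      case True
      have "q \<noteq> 0" using q Suc by auto
      then have "Polynomial.degree p = Suc (Polynomial.degree q)" unfolding q by (subst degree_mult_eq) auto
      with Suc True \<open>q \<noteq> 0\<close> show ?thesis by simp
    next
      case False
      have "A (poly_op A q v) = c *s poly_op A q v"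
        using Suc.prems q poly_op_linear_factor[OF A, of c q v] by simp
      with False poly_op_in[of W A v q] W v show ?thesis by blast
    qed
  qed
qed

text \<open>
  Over an algebraically closed field this is equivalent to nilpotency of \<open>A - 1\<close> on \<open>V\<close>; the form with
  eigenvalues is the one that arguments with eigenvectors deliver.
\<close>
definition unipotent :: "('v \<Rightarrow> 'v) \<Rightarrow> bool" where
  "unipotent A \<longleftrightarrow> (\<forall>v\<in>V. \<forall>c. v \<noteq> 0 \<longrightarrow> A v = c *s v \<longrightarrow> c = 1)"

text \<open>
  In an annihilating polynomial of \<open>v\<close>, a linear factor \<open>x - c\<close> with \<open>c \<noteq> 1\<close> may be dropped, since
  \<open>A - c\<close> is injective. Only powers of \<open>x - 1\<close> remain.
\<close>
lemma unipotent_nilpotent: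
  assumes A: "operator A" "unipotent A" and v: "v \<in> V"
  shows "\<exists>j. ((\<lambda>w. A w - w) ^^ j) v = 0"
proof -
  obtain p where "p \<noteq> 0" "poly_op A p v = 0" using annihilating_poly_exists A v by blast
  then show ?thesis using v
  proof (induction "Polynomial.degree p" arbitrary: p v)
    case 0
    then obtain c where "p = [:c:]" by (metis degree_eq_zeroE)
    with 0 show ?case by (auto simp: poly_op_def intro!: exI[of _ 0])
  next
    case (Suc d)
    obtain c where "poly p c = 0" using alg_closed_imp_poly_has_root[of p] Suc by auto
    then obtain q where q: "p = [:- c, 1:] * q" using poly_eq_0_iff_dvd by (auto simp: dvd_def)
    have "q \<noteq> 0" using q Suc by auto
    then have "Polynomial.degree p = Suc (Polynomial.degree q)" unfolding q by (subst degree_mult_eq) auto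
    then have d: "d = Polynomial.degree q" using Suc(2) by simp
    have qV: "poly_op A q v \<in> V"
      using poly_op_in[of V A v q] A Suc.prems subspace_V by auto
    have eig: "A (poly_op A q v) = c *s poly_op A q v"
      using Suc.prems q poly_op_linear_factor[OF A(1), of c q v] by simp
    show ?case
    proof (cases "c = 1")
      case True
      have "poly_op A q (A v - v) = A (poly_op A q v) - poly_op A q v"
      proof (rule poly_op_commute)
        show "operator (\<lambda>w. A w - w)"
          using A(1) by (auto simp: operator_def scale_right_diff_distrib)
        show "A (A v - v) = A (A v) - A v" for v by (rule operator_diff[OF A(1)])
      qed (use A Suc.prems in auto)
      then have "poly_op A q (A v - v) = 0" using eig True by simp
      then obtain j where "((\<lambda>w. A w - w) ^^ j) (A v - v) = 0"
        using Suc.hyps(1)[OF d \<open>q \<noteq> 0\<close>, of "A v - v"] A Suc.prems by auto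
      then show ?thesis by (intro exI[of _ "Suc j"]) (simp add: funpow_Suc_right del: funpow.simps)
    next
      case False
      then have "poly_op A q v = 0" using eig qV A(2) unfolding unipotent_def by blast
      then show ?thesis using Suc.hyps(1)[OF d \<open>q \<noteq> 0\<close>] Suc.prems by blast
    qed
  qed
qed

text \<open>
  A fixed vector of \<open>Y\<close> modulo \<open>W\<close>, without forming a quotient: apply \<open>A - 1\<close> to a vector of \<open>Y\<close> outside
  \<open>W\<close> until it falls into \<open>W\<close>, and take the last vector before that.
\<close>
lemma relative_fixed_vector:
  assumes A: "operator A" "unipotent A" and Y: "subspace Y" "Y \<subseteq> V" "\<And>y. y \<in> Y \<Longrightarrow> A y \<in> Y"
    and W: "subspace W" and v: "v \<in> Y - W"
  shows "\<exists>w \<in> Y - W. A w - w \<in> W"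
proof -
  define D where "D = (\<lambda>w. A w - w)"
  obtain j where j: "(D ^^ j) v = 0" using unipotent_nilpotent[OF A, of v] v Y unfolding D_def by blast
  define i where "i = (LEAST i. (D ^^ i) v \<in> W)"
  have iW: "(D ^^ i) v \<in> W" unfolding i_def by (rule LeastI[of _ j]) (simp add: j subspace_0[OF W])
  have "i \<noteq> 0" using iW v by (cases i) auto
  then obtain k where k: "i = Suc k" by (cases i) auto
  have "(D ^^ k) v \<notin> W" using not_less_Least[of k "\<lambda>i. (D ^^ i) v \<in> W"] k i_def by auto
  moreover have "(D ^^ l) v \<in> Y" for l
    by (induction l) (use v Y in \<open>auto simp: D_def intro!: subspace_diff\<close>)
  ultimately show ?thesis using iW k by (auto simp: D_def)
qed

lemma joint_eigenvector_exists:
  assumes "finite I" and "\<And>i. i \<in> I \<Longrightarrow> operator (A i)"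
    and "\<And>i j w. i \<in> I \<Longrightarrow> j \<in> I \<Longrightarrow> w \<in> W \<Longrightarrow> A i (A j w) = A j (A i w)"
    and "subspace W" "W \<subseteq> V" "\<And>i w. i \<in> I \<Longrightarrow> w \<in> W \<Longrightarrow> A i w \<in> W"
    and "v \<in> W" "v \<noteq> 0"
  shows "\<exists>w\<in>W. w \<noteq> 0 \<and> (\<exists>c. \<forall>i\<in>I. A i w = c i *s w)"
  using assms
proof (induction I arbitrary: W v rule: finite_induct)
  case (insert x I)
  obtain w c where w: "w \<in> W" "w \<noteq> 0" "A x w = c *s w"
    using eigenvector_exists[of "A x" W v] insert.prems by blast
  define W' where "W' = {w \<in> W. A x w = c *s w}"
  have "\<exists>w\<in>W'. w \<noteq> 0 \<and> (\<exists>c. \<forall>i\<in>I. A i w = c i *s w)"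
  proof (rule insert.IH[where v = w])
    show "subspace W'"
      using insert.prems(1,3) unfolding W'_def subspace_def
      by (auto simp: operator_add operator_scale scale_right_distrib mult.commute)
    show "\<And>i w. i \<in> I \<Longrightarrow> w \<in> W' \<Longrightarrow> A i w \<in> W'"
      using insert.prems unfolding W'_def by (auto simp: operator_scale) 
  qed (use w insert.prems in \<open>auto simp: W'_def\<close>)
  then obtain u d where u: "u \<in> W'" "u \<noteq> 0" "\<forall>i\<in>I. A i u = d i *s u" by blast
  then show ?case using insert.hyps
    by (intro bexI[of _ u] conjI exI[of _ "d(x := c)"]) (auto simp: W'_def)
qed auto

text \<open>
  Joint eigenvectors for pairwise different systems of eigenvalues are linearly independent. Given a
  relation, apply \<open>A\<^sub>i - c\<^sub>s\<^sub>i\<close> to remove the member \<open>s\<close>; the induction hypothesis kills every coefficient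
  at a \<open>t\<close> that is told apart from \<open>s\<close> by the index \<open>i\<close>.
\<close>
lemma joint_eigenvectors_card_le:
  assumes "finite T" and op: "\<And>i. i \<in> I \<Longrightarrow> operator (A i)"
    and v: "\<And>t. t \<in> T \<Longrightarrow> v t \<in> V" "\<And>t. t \<in> T \<Longrightarrow> v t \<noteq> 0"
    and eig: "\<And>t i. t \<in> T \<Longrightarrow> i \<in> I \<Longrightarrow> A i (v t) = c t i *s v t"
    and dist: "\<And>s t. s \<in> T \<Longrightarrow> t \<in> T \<Longrightarrow> s \<noteq> t \<Longrightarrow> \<exists>i\<in>I. c s i \<noteq> c t i"
  shows "card T \<le> n"
proof -
  have "\<forall>t\<in>T. a t = 0" if "(\<Sum>t\<in>T. a t *s v t) = 0" for a
    using assms that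
  proof (induction T arbitrary: a rule: finite_induct)
    case (insert s T)
    have T: "a t = 0" if t: "t \<in> T" for t
    proof -
      obtain i where i: "i \<in> I" "c s i \<noteq> c t i"
        using insert.prems(5)[of s t] insert.hyps t by auto
      have "0 = A i (\<Sum>t\<in>insert s T. a t *s v t) - c s i *s (\<Sum>t\<in>insert s T. a t *s v t)"
        unfolding insert.prems(6) using operator_zero[OF insert.prems(1)[OF i(1)]] by simp
      also have "\<dots> = (\<Sum>t\<in>insert s T. (a t * (c t i - c s i)) *s v t)"
        unfolding operator_sum[OF insert.prems(1)[OF i(1)]] scale_sum_right sum_subtractf [symmetric]
        by (intro sum.cong refl, unfold operator_scale[OF insert.prems(1)[OF i(1)]])
          (simp add: insert.prems(4)[OF _ i(1)] scale_left_diff_distrib right_diff_distrib mult.commute)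
      also have "\<dots> = (\<Sum>t\<in>T. (a t * (c t i - c s i)) *s v t)"
        using insert.hyps by simp
      finally have "(\<Sum>t\<in>T. (a t * (c t i - c s i)) *s v t) = 0" by simp
      then have "\<forall>t\<in>T. a t * (c t i - c s i) = 0"
        using insert.prems(1-5) by (intro insert.IH) (blast intro: insertI2)+
      then show ?thesis using i t by auto
    qed
    then have "(\<Sum>t\<in>T. a t *s v t) = 0" by simp
    then have "a s *s v s = 0" using insert.prems(6) insert.hyps by simp
    then show ?case using T insert.prems(3)[of s] by auto
  qed auto
  then show ?thesis using independent_family_card_le[of T v] assms(1) v by blast
qed

end

section \<open>Representations, unipotent series and flags\<close>

locale linear_rep = bounded_space scale V n + group G
  for scale :: "'k :: alg_closed_field \<Rightarrow> 'v :: ab_group_add \<Rightarrow> 'v" (infixr "*s" 75)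
    and V :: "'v set" and n :: nat and G :: "('g, 'b) monoid_scheme" (structure) +
  fixes T :: "'g \<Rightarrow> 'v \<Rightarrow> 'v"
  assumes T_operator: "g \<in> carrier G \<Longrightarrow> operator (T g)"
    and T_mult: "g \<in> carrier G \<Longrightarrow> h \<in> carrier G \<Longrightarrow> v \<in> V \<Longrightarrow> T (g \<otimes> h) v = T g (T h v)"
    and T_one: "v \<in> V \<Longrightarrow> T \<one> v = v"
begin

lemma T_V [simp]: "g \<in> carrier G \<Longrightarrow> v \<in> V \<Longrightarrow> T g v \<in> V"
  using T_operator by simp

lemma T_inv_left: "g \<in> carrier G \<Longrightarrow> v \<in> V \<Longrightarrow> T (inv g) (T g v) = v"
  using T_mult[of "inv g" g v] T_one[of v] by simp

lemma T_nonzero: "g \<in> carrier G \<Longrightarrow> v \<in> V \<Longrightarrow> v \<noteq> 0 \<Longrightarrow> T g v \<noteq> 0"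
  using T_inv_left[of g v] operator_zero[OF T_operator[of "inv g"]] by force

lemma T_scale: "g \<in> carrier G \<Longrightarrow> T g (c *s v) = c *s T g v"
  by (rule operator_scale[OF T_operator])

lemma T_add: "g \<in> carrier G \<Longrightarrow> T g (v + w) = T g v + T g w"
  by (rule operator_add[OF T_operator])

lemma T_diff: "g \<in> carrier G \<Longrightarrow> T g (v - w) = T g v - T g w"
  by (rule operator_diff[OF T_operator])

lemma T_eigenvalue_nonzero:
  "g \<in> carrier G \<Longrightarrow> v \<in> V \<Longrightarrow> v \<noteq> 0 \<Longrightarrow> T g v = c *s v \<Longrightarrow> c \<noteq> 0"
  using T_nonzero[of g v] by auto

lemma eigenspace_subspace: "g \<in> carrier G \<Longrightarrow> subspace {v \<in> V. T g v = c *s v}"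
  unfolding subspace_def by (auto simp: T_add T_scale scale_right_distrib T_operator mult.commute)

text \<open>
  For a commutator \<open>z\<close> of \<open>x\<close> and \<open>y\<close> that commutes with both, unipotency of \<open>x\<close> suffices. On the
  eigenspace of \<open>z\<close> for \<open>c\<close> there is a vector \<open>w\<close> fixed by \<open>x\<close>, and then \<open>y w\<close> is an eigenvector of \<open>x\<close>
  with eigenvalue \<open>c\<close>.
\<close>
lemma unipotent_commutator:
  assumes [simp]: "x \<in> carrier G" "y \<in> carrier G" "z \<in> carrier G"
    and comm: "x \<otimes> y = z \<otimes> y \<otimes> x" "z \<otimes> x = x \<otimes> z" "z \<otimes> y = y \<otimes> z"
    and x: "unipotent (T x)"
  shows "unipotent (T z)"
  unfolding unipotent_def
proof (intro ballI allI impI)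
  fix v c assume v: "v \<in> V" "v \<noteq> 0" "T z v = c *s v"
  let ?W = "{w \<in> V. T z w = c *s w}"
  have "\<exists>w a. w \<in> ?W \<and> w \<noteq> 0 \<and> T x w = a *s w"
  proof (rule eigenvector_exists[of "T x" ?W v])
    show "T x w \<in> ?W" if "w \<in> ?W" for w
      using that comm(2) T_mult[of z x w] T_mult[of x z w] by (auto simp: T_scale)
  qed (use v T_operator eigenspace_subspace in auto)
  then obtain w a where w: "w \<in> V" "T z w = c *s w" "w \<noteq> 0" "T x w = a *s w" by blast
  then have "a = 1" using x unfolding unipotent_def by blast
  then have "T x (T y w) = T z (T y w)"
    using w comm(1) T_mult[of x y w] T_mult[of "z \<otimes> y" x w] T_mult[of z y w] by simp
  also have "\<dots> = c *s T y w"
    using w comm(3) T_mult[of z y w] T_mult[of y z w] by (simp add: T_scale)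
  finally show "c = 1"
    using x w T_nonzero[of y w] T_V[of y w] assms(2) unfolding unipotent_def by blast
qed

lemma unipotent_inv:
  assumes g: "g \<in> carrier G" and unip: "unipotent (T g)"
  shows "unipotent (T (inv g))"
  unfolding unipotent_def
proof (intro ballI allI impI)
  fix v c assume v: "v \<in> V" "v \<noteq> 0" "T (inv g) v = c *s v"
  have "v = T g (c *s v)" using T_inv_left[of "inv g" v] g v by simp
  then have "v = c *s T g v" using g by (simp add: T_scale)
  moreover have "c \<noteq> 0" using T_eigenvalue_nonzero[of "inv g" v c] g v by simp
  ultimately have "T g v = inverse c *s v" by (metis scale_left_imp_eq scale_scale right_inverse scale_one)
  then have "inverse c = 1" using unip v unfolding unipotent_def by blast
  then show "c = 1" by simp
qed

lemma inv_swap: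
  assumes "z \<in> carrier G" "h \<in> carrier G" "x \<in> carrier G" "z \<otimes> h = h \<otimes> x"
  shows "x \<otimes> inv h = inv h \<otimes> z"
proof -
  have "inv h \<otimes> z = inv h \<otimes> (z \<otimes> h) \<otimes> inv h" using assms(1-3) by (simp add: m_assoc)
  also have "\<dots> = x \<otimes> inv h" using assms(1-3) by (simp add: assms(4) m_assoc [symmetric])
  finally show ?thesis by simp
qed

text \<open>
  Generators of a group that arises from the trivial one by adjoining unipotent elements, each of them
  normalising the group built so far. Conjugation in one direction is enough for Kolchin's argument.
\<close>
inductive unipotent_series :: "'g set \<Rightarrow> bool" where
  unipotent_series_empty: "unipotent_series {}"
| unipotent_series_insert:
    "unipotent_series D \<Longrightarrow> y \<in> carrier G \<Longrightarrow> unipotent (T y) \<Longrightarrow>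
     (\<And>d. d \<in> D \<Longrightarrow> \<exists>c\<in>generate G D. y \<otimes> d = c \<otimes> y) \<Longrightarrow> unipotent_series (insert y D)"

lemma unipotent_series_carrier: "unipotent_series D \<Longrightarrow> D \<subseteq> carrier G"
  by (induction rule: unipotent_series.induct) auto

lemma fixed_modulo_subspace:
  assumes S: "S \<subseteq> carrier G" and W: "subspace W"
  shows "subspace {v \<in> V. \<forall>h\<in>S. T h v - v \<in> W}" (is "subspace ?Y")
  unfolding subspace_def
proof (intro conjI ballI allI)
  show "0 \<in> ?Y" using S W by (auto simp: subspace_0 T_operator subset_iff)
  show "v + w \<in> ?Y" if "v \<in> ?Y" "w \<in> ?Y" for v w
  proof -
    have "T h (v + w) - (v + w) \<in> W" if h: "h \<in> S" for h
    proof -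
      have "T h (v + w) - (v + w) = (T h v - v) + (T h w - w)" using h S by (auto simp: T_add)
      then show ?thesis using subspace_add[OF W] \<open>v \<in> ?Y\<close> \<open>w \<in> ?Y\<close> h by (metis (lifting) mem_Collect_eq)
    qed
    then show ?thesis using that by auto
  qed
  show "c *s v \<in> ?Y" if "v \<in> ?Y" for c v
  proof -
    have "T h (c *s v) - c *s v \<in> W" if h: "h \<in> S" for h
    proof -
      have "T h (c *s v) - c *s v = c *s (T h v - v)" using h S by (auto simp: T_scale scale_right_diff_distrib)
      then show ?thesis using subspace_scale[OF W] \<open>v \<in> ?Y\<close> h by (metis (lifting) mem_Collect_eq)
    qed
    then show ?thesis using that by auto
  qed
qed

text \<open>Being fixed modulo an invariant subspace needs to be checked on generators only.\<close>
lemma generate_fixes_modulo: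
  assumes D: "D \<subseteq> carrier G" and W: "subspace W" "W \<subseteq> V"
    and inv: "\<And>h w. h \<in> generate G D \<Longrightarrow> w \<in> W \<Longrightarrow> T h w \<in> W"
    and v: "v \<in> V" "\<And>d. d \<in> D \<Longrightarrow> T d v - v \<in> W" and h: "h \<in> generate G D"
  shows "T h v - v \<in> W"
  using h
proof (induction rule: generate.induct)
  case one
  then show ?case using W v by (simp add: T_one subspace_0)
next
  case (inv d)
  have "T (inv d) v - v = - T (inv d) (T d v - v)"
    using inv D v by (auto simp: T_diff T_inv_left)
  then show ?case using inv v assms(4)[OF generate.inv[OF inv]] W by (metis subspace_neg)
next
  case (eng g h)
  then have gh: "g \<in> carrier G" "h \<in> carrier G" using generate_in_carrier[OF D] by auto
  have "T (g \<otimes> h) v - v = T g (T h v - v) + (T g v - v)"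
    using gh v by (simp add: T_mult T_diff)
  then show ?case using subspace_add[OF W(1) inv[OF eng(1,4)] eng(3)] by (simp only:)
qed (use v in auto)

text \<open>
  Kolchin's theorem in relative form: a vector that is fixed modulo \<open>W\<close>. The vectors fixed modulo \<open>W\<close>
  by the group built so far form a subspace \<open>Y\<close>, which the next element \<open>y\<close> preserves because \<open>y\<close>
  normalises that group. Being unipotent, \<open>y\<close> has a fixed vector in \<open>Y\<close> modulo \<open>W\<close>.
\<close>
lemma unipotent_series_fixed_vector:
  assumes "unipotent_series D" "subspace W" "W \<subset> V"
    and "\<And>h w. h \<in> generate G D \<Longrightarrow> w \<in> W \<Longrightarrow> T h w \<in> W"
  shows "\<exists>v\<in>V - W. \<forall>h\<in>generate G D. T h v - v \<in> W"
  using assms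
proof (induction rule: unipotent_series.induct)
  case unipotent_series_empty
  then obtain v where "v \<in> V - W" by blast
  then show ?case
    using generate_fixes_modulo[of "{}" W v] unipotent_series_empty by (intro bexI[of _ v]) auto
next
  case (unipotent_series_insert D y)
  note [simp] = unipotent_series_insert.hyps(2)
  have D: "D \<subseteq> carrier G" using unipotent_series_carrier unipotent_series_insert.hyps(1) .
  have gen: "generate G D \<subseteq> generate G (insert y D)" by (intro mono_generate) auto
  have WV: "W \<subseteq> V" using unipotent_series_insert.prems by blast
  define Y where "Y = {v \<in> V. \<forall>h\<in>generate G D. T h v - v \<in> W}"
  have car: "h \<in> carrier G" if "h \<in> generate G D" for h using generate_in_carrier[OF D that] .
  have invD: "\<And>h w. h \<in> generate G D \<Longrightarrow> w \<in> W \<Longrightarrow> T h w \<in> W"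
    using unipotent_series_insert.prems gen by blast
  have yW: "\<And>w. w \<in> W \<Longrightarrow> T y w \<in> W" "\<And>w. w \<in> W \<Longrightarrow> T (inv y) w \<in> W"
    using unipotent_series_insert.prems generate.incl[of y "insert y D" G] generate.inv[of y "insert y D" G]
    by blast+
  obtain v where v: "v \<in> Y - W"
    using unipotent_series_insert.IH[OF unipotent_series_insert.prems(1,2) invD] by (auto simp: Y_def)
  \<comment> \<open>The normality condition transports \<open>Y\<close> along \<open>inv y\<close>; the result is turned back to \<open>y\<close> below.\<close>
  have "\<exists>w\<in>Y - W. T (inv y) w - w \<in> W"
  proof (rule relative_fixed_vector)
    show "subspace Y" unfolding Y_def
      using car unipotent_series_insert.prems(1) by (intro fixed_modulo_subspace) auto
    show "T (inv y) u \<in> Y" if u: "u \<in> Y" for u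
    proof -
      have uV: "u \<in> V" using u by (simp add: Y_def)
      have "T d (T (inv y) u) - T (inv y) u \<in> W" if d: "d \<in> D" for d
      proof -
        obtain c where c: "c \<in> generate G D" "y \<otimes> d = c \<otimes> y"
          using unipotent_series_insert.hyps(4)[OF d] by blast
        have dc: "d \<in> carrier G" using d D by blast
        have "T d (T (inv y) u) = T (inv y) (T c u)"
          using inv_swap[OF car[OF c(1)] _ dc, of y] c(2) uV car[OF c(1)] dc
            T_mult[of d "inv y" u] T_mult[of "inv y" c u] by simp
        then have "T d (T (inv y) u) - T (inv y) u = T (inv y) (T c u - u)" by (simp add: T_diff)
        then show ?thesis using yW(2) u c(1) by (auto simp: Y_def)
      qed
      then have "\<forall>h\<in>generate G D. T h (T (inv y) u) - T (inv y) u \<in> W"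
        using generate_fixes_modulo[OF D unipotent_series_insert.prems(1) WV invD, of "T (inv y) u"] uV by simp
      then show ?thesis using uV by (simp add: Y_def)
    qed
  qed (use v unipotent_series_insert T_operator unipotent_inv in \<open>auto simp: Y_def\<close>)
  then obtain w where w: "w \<in> Y - W" "T (inv y) w - w \<in> W" by blast
  have "T y w - w = - T y (T (inv y) w - w)"
    using w(1) T_inv_left[of "inv y" w] by (simp add: T_diff Y_def)
  then have w: "w \<in> Y - W" "T y w - w \<in> W"
    using w(1) subspace_neg[OF unipotent_series_insert.prems(1) yW(1)[OF w(2)]] by simp_all
  have wV: "w \<in> V" and wD: "\<And>d. d \<in> D \<Longrightarrow> T d w - w \<in> W"
    using w generate.incl[of _ D G] by (auto simp: Y_def)
  have "T h w - w \<in> W" if "h \<in> generate G (insert y D)" for h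
    by (rule generate_fixes_modulo[OF _ unipotent_series_insert.prems(1) WV unipotent_series_insert.prems(3) wV _ that])
      (use wD w(2) D in auto)
  then show ?case using w wV by blast
qed

text \<open>The ascending flag of iterated fixed spaces of the group generated by \<open>D\<close>.\<close>
primrec flag :: "'g set \<Rightarrow> nat \<Rightarrow> 'v set" where
  "flag D 0 = {0}"
| "flag D (Suc i) = {v \<in> V. \<forall>h\<in>generate G D. T h v - v \<in> flag D i}"

lemma flag_V: "flag D i \<subseteq> V"
  by (cases i) auto

lemma flag_subspace:
  assumes "D \<subseteq> carrier G" shows "subspace (flag D i)"
proof (induction i)
  case (Suc i)
  have "generate G D \<subseteq> carrier G" using generate_in_carrier[OF assms] by blast
  then show ?case using fixed_modulo_subspace[OF _ Suc] by simp
qed simp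

lemma flag_mono:
  assumes "D \<subseteq> carrier G" and "i \<le> j" shows "flag D i \<subseteq> flag D j"
proof -
  have "flag D i \<subseteq> flag D (Suc i)" for i
  proof (induction i)
    case 0
    then show ?case using generate_in_carrier[OF assms(1)] by (auto simp: T_operator)
  qed auto
  then show ?thesis using lift_Suc_mono_le assms(2) by blast
qed

lemma flag_invariant:
  assumes D: "D \<subseteq> carrier G" and h: "h \<in> generate G D" and v: "v \<in> flag D i"
  shows "T h v \<in> flag D i"
proof -
  have "T h v - v \<in> flag D i"
    using flag_mono[OF D, of i "Suc i"] flag_mono[OF D, of "i - 1" i] h v
    by (cases i) (auto simp: T_operator generate_in_carrier[OF D])
  from subspace_add[OF flag_subspace[OF D] this v] show ?thesis by simp
qed

text \<open>
  Before it reaches \<open>V\<close>, the flag grows strictly by \<open>unipotent_series_fixed_vector\<close>. Vectors chosen in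
  the successive differences are linearly independent, so there are at most \<open>n\<close> of them.
\<close>
lemma flag_exhausts:
  assumes D: "unipotent_series D" and "n \<le> i" shows "flag D i = V"
proof (rule ccontr)
  assume "flag D i \<noteq> V"
  have DC: "D \<subseteq> carrier G" using unipotent_series_carrier[OF D] .
  have ne: "flag D j \<subset> V" if "j \<le> n" for j
    using \<open>flag D i \<noteq> V\<close> flag_mono[OF DC, of j i] flag_V that assms(2) by (metis le_trans psubsetI subset_antisym)
  have "\<exists>v. v \<in> flag D (Suc j) - flag D j" if "j \<le> n" for j
    using unipotent_series_fixed_vector[OF D flag_subspace[OF DC] ne[OF that]]
      flag_invariant[OF DC] by auto
  then obtain u where u: "\<And>j. j \<le> n \<Longrightarrow> u j \<in> flag D (Suc j) - flag D j" by metis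
  have "\<forall>j<m. c j = 0" if "(\<Sum>j<m. c j *s u j) = 0" "m \<le> Suc n" for m c
    using that
  proof (induction m)
    case (Suc m)
    have "(\<Sum>j<m. c j *s u j) \<in> flag D m"
    proof (intro subspace_sum subspace_scale flag_subspace[OF DC])
      fix j assume "j \<in> {..<m}"
      then show "u j \<in> flag D m" using u[of j] flag_mono[OF DC, of "Suc j" m] Suc.prems by auto
    qed
    moreover have "(\<Sum>j<m. c j *s u j) + c m *s u m = 0" using Suc.prems by simp
    then have "c m *s u m = - (\<Sum>j<m. c j *s u j)" by (rule add.inverse_unique [symmetric, THEN trans[rotated], OF _ refl])
    ultimately have cu: "c m *s u m \<in> flag D m" using subspace_neg[OF flag_subspace[OF DC]] by metis
    have "c m = 0"
    proof (rule ccontr)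
      assume "c m \<noteq> 0"
      then have "u m = inverse (c m) *s (c m *s u m)" by simp
      then have "u m \<in> flag D m" using cu subspace_scale[OF flag_subspace[OF DC]] by metis
      then show False using u[of m] Suc.prems by auto
    qed
    then show ?case using Suc by (auto simp: less_Suc_eq)
  qed simp
  note zero = this
  have "card {..<Suc n} \<le> n"
  proof (rule independent_family_card_le)
    show "u j \<in> V" if "j \<in> {..<Suc n}" for j
      using u[of j] that flag_V[of D "Suc j"] by auto
    show "c j = 0" if "(\<Sum>j<Suc n. c j *s u j) = 0" "j \<in> {..<Suc n}" for c j
      using zero[OF that(1)] that(2) by simp
  qed simp
  then show False by simp
qed

text \<open>The operator \<open>h - 1\<close> maps each member of the flag into the one \<open>s\<close> steps below.\<close>
definition lowers :: "'g set \<Rightarrow> 'g \<Rightarrow> nat \<Rightarrow> bool" where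
  "lowers D h s \<longleftrightarrow> h \<in> generate G D \<and> (\<forall>i. \<forall>v\<in>flag D (i + s). T h v - v \<in> flag D i)"

lemma lowers_one: "h \<in> generate G D \<Longrightarrow> lowers D h 1"
  by (auto simp: lowers_def)

text \<open>
  With \<open>g h = z h g\<close> the identity \<open>(z - 1) h g = (g - 1)(h - 1) - (h - 1)(g - 1)\<close> holds, and \<open>h g\<close>
  maps every member of the flag onto itself.
\<close>
lemma lowers_commutator:
  assumes D: "D \<subseteq> carrier G" and g: "lowers D g p" and h: "lowers D h q"
    and z: "z \<in> carrier G" "g \<otimes> h = z \<otimes> h \<otimes> g"
  shows "lowers D z (p + q)"
proof -
  have gh: "g \<in> generate G D" "h \<in> generate G D" using g h by (auto simp: lowers_def)
  then have [simp]: "g \<in> carrier G" "h \<in> carrier G" using generate_in_carrier[OF D] by auto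
  have hg: "h \<otimes> g \<in> generate G D" using gh by (intro generate.eng)
  have "z = g \<otimes> h \<otimes> inv (h \<otimes> g)" using z by (simp add: m_assoc inv_solve_right)
  moreover have "inv (h \<otimes> g) \<in> generate G D"
    using subgroup.m_inv_closed[OF generate_is_subgroup[OF D] hg] .
  ultimately have zD: "z \<in> generate G D" using gh by (simp add: generate.eng)
  have "T z u - u \<in> flag D i" if u: "u \<in> flag D (i + (p + q))" for u i
  proof -
    have uV: "u \<in> V" using u flag_V by blast
    define v where "v = T (inv (h \<otimes> g)) u"
    have v: "v \<in> flag D (i + (p + q))"
      unfolding v_def using subgroup.m_inv_closed[OF generate_is_subgroup[OF D] hg] u
      by (intro flag_invariant[OF D])
    then have vV: "v \<in> V" using flag_V by blast
    have "u = T (h \<otimes> g) v"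
      unfolding v_def using T_inv_left[of "inv (h \<otimes> g)" u] uV by simp
    then have uv: "u = T h (T g v)" using vV by (simp add: T_mult)
    have "T z u = T (z \<otimes> h \<otimes> g) v"
      using vV z(1) by (simp add: uv T_mult)
    also have "\<dots> = T g (T h v)" using z vV by (simp add: z(2)[symmetric] T_mult)
    finally have "T z u - u = (T g (T h v - v) - (T h v - v)) - (T h (T g v - v) - (T g v - v))"
      by (simp add: uv T_diff algebra_simps)
    moreover have "T h v - v \<in> flag D (i + p)"
      using h v unfolding lowers_def by (metis add.assoc)
    then have "T g (T h v - v) - (T h v - v) \<in> flag D i" using g by (auto simp: lowers_def)
    moreover have "T g v - v \<in> flag D (i + q)"
      using g v unfolding lowers_def by (metis add.assoc add.commute)
    then have "T h (T g v - v) - (T g v - v) \<in> flag D i" using h by (auto simp: lowers_def)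
    ultimately show ?thesis using subspace_diff[OF flag_subspace[OF D]] by metis
  qed
  with zD show ?thesis by (auto simp: lowers_def)
qed

definition rep_kernel :: "'g set" where
  "rep_kernel = {g \<in> carrier G. \<forall>v\<in>V. T g v = v}"

lemma lowers_imp_kernel:
  assumes D: "unipotent_series D" and z: "lowers D z s" and s: "n \<le> s"
  shows "z \<in> rep_kernel"
proof -
  have "T z v - v \<in> flag D 0" if "v \<in> V" for v
    using z flag_exhausts[OF D s] that unfolding lowers_def by (metis add_0)
  moreover have "z \<in> carrier G"
    using z generate_in_carrier[OF unipotent_series_carrier[OF D]] by (auto simp: lowers_def)
  ultimately show ?thesis by (auto simp: rep_kernel_def)
qed

lemma subgroup_rep_kernel: "subgroup rep_kernel G"
proof (rule subgroupI)
  show "inv g \<in> rep_kernel" if "g \<in> rep_kernel" for g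
  proof -
    have "T (inv g) v = v" if "v \<in> V" for v
      using T_inv_left[of g v] \<open>g \<in> rep_kernel\<close> that by (auto simp: rep_kernel_def)
    then show ?thesis using that by (auto simp: rep_kernel_def)
  qed
qed (auto simp: rep_kernel_def T_mult intro: exI[of _ \<one>] T_one)

lemma commutator_in_kernel:
  assumes "g \<in> carrier G" "h \<in> carrier G" "z \<in> carrier G" "g \<otimes> h = z \<otimes> h \<otimes> g"
    and "g \<in> rep_kernel \<or> h \<in> rep_kernel"
  shows "z \<in> rep_kernel"
proof -
  have "T z v = v" if v: "v \<in> V" for v
  proof -
    define u where "u = T (inv (h \<otimes> g)) v"
    have u: "u \<in> V" "v = T h (T g u)"
      using T_inv_left[of "inv (h \<otimes> g)" v] v assms by (auto simp: u_def T_mult)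
    then have "T z v = T (z \<otimes> h \<otimes> g) u" using assms by (simp add: T_mult)
    also have "\<dots> = T g (T h u)" using assms u by (simp add: assms(4)[symmetric] T_mult)
    also have "\<dots> = v" using assms u by (auto simp: rep_kernel_def)
    finally show ?thesis .
  qed
  then show ?thesis using assms by (auto simp: rep_kernel_def)
qed

text \<open>
  Elements \<open>e i j r\<close> that satisfy the commutator relation whenever the three indices lie in different
  classes. For elementary matrices each index is its own class; for unitary ones \<open>l\<close> and \<open>\<sigma> l\<close> form one
  class. A trivial \<open>e p q 1\<close> makes its row and its column trivial, and the argument repeats from there.
  A third class provides room for the detours that are needed when two indices share a class.
\<close>
lemma root_elements_in_kernel:
  fixes e :: "nat \<Rightarrow> nat \<Rightarrow> 'r :: {ring, monoid_mult} \<Rightarrow> 'g" and cls :: "nat \<Rightarrow> nat"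
  assumes car: "\<And>i j r. i \<in> I \<Longrightarrow> j \<in> I \<Longrightarrow> cls i \<noteq> cls j \<Longrightarrow> e i j r \<in> carrier G"
    and rel: "\<And>i j l r s. i \<in> I \<Longrightarrow> j \<in> I \<Longrightarrow> l \<in> I \<Longrightarrow> cls i \<noteq> cls j \<Longrightarrow> cls j \<noteq> cls l \<Longrightarrow> cls i \<noteq> cls l \<Longrightarrow>
      e i j r \<otimes> e j l s = e i l (r * s) \<otimes> e j l s \<otimes> e i j r"
    and third: "\<And>i j. i \<in> I \<Longrightarrow> j \<in> I \<Longrightarrow> \<exists>l\<in>I. cls l \<noteq> cls i \<and> cls l \<noteq> cls j"
    and pq: "p \<in> I" "q \<in> I" "cls p \<noteq> cls q" "e p q 1 \<in> rep_kernel"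
    and ij: "i \<in> I" "j \<in> I" "cls i \<noteq> cls j"
  shows "e i j r \<in> rep_kernel"
proof -
  have step: "e a j r \<in> rep_kernel"
    if "a \<in> I" "b \<in> I" "j \<in> I" "cls a \<noteq> cls b" "cls a \<noteq> cls j" "cls b \<noteq> cls j"
      "e a b 1 \<in> rep_kernel \<or> e b j 1 \<in> rep_kernel" for a b j r
  proof -
    from that(7) show ?thesis
    proof
      assume "e a b 1 \<in> rep_kernel"
      with that(1-6) show ?thesis
        using commutator_in_kernel[OF car[of a b 1] car[of b j r] car[of a j r]] rel[of a b j 1 r] by simp
    next
      assume "e b j 1 \<in> rep_kernel"
      with that(1-6) show ?thesis
        using commutator_in_kernel[OF car[of a b r] car[of b j 1] car[of a j r]] rel[of a b j r 1] by simp
    qed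
  qed
  have row: "e a j r \<in> rep_kernel"
    if ab: "a \<in> I" "b \<in> I" "cls a \<noteq> cls b" "e a b 1 \<in> rep_kernel" and j: "j \<in> I" "cls j \<noteq> cls a" for a b j r
  proof (cases "cls j = cls b")
    case True
    obtain c where c: "c \<in> I" "cls c \<noteq> cls a" "cls c \<noteq> cls b" using third ab by blast
    then have "e a c 1 \<in> rep_kernel" using step[of a b c] ab by auto
    then show ?thesis using step[of a c j] c ab j True by auto
  next
    case False
    then show ?thesis using step[of a b j] ab j by auto
  qed
  have col: "e i b r \<in> rep_kernel"
    if ab: "a \<in> I" "b \<in> I" "cls a \<noteq> cls b" "e a b 1 \<in> rep_kernel" and i: "i \<in> I" "cls i \<noteq> cls b" for a b i r
  proof (cases "cls i = cls a")
    case True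
    obtain c where c: "c \<in> I" "cls c \<noteq> cls a" "cls c \<noteq> cls b" using third ab by blast
    then have "e c b 1 \<in> rep_kernel" using step[of c a b] ab by auto
    then show ?thesis using step[of i c b] c ab i True by auto
  next
    case False
    then show ?thesis using step[of i a b] ab i by auto
  qed
  show ?thesis
  proof (cases "cls j = cls p")
    case True
    obtain c where c: "c \<in> I" "cls c \<noteq> cls p" "cls c \<noteq> cls i" using third pq ij by blast
    have "e p c 1 \<in> rep_kernel" using row[OF pq c(1,2)] .
    then have "e i c 1 \<in> rep_kernel" using col[of p c i] c pq ij by auto
    then show ?thesis using row[of i c j] c ij by auto
  next
    case False
    then have "e p j 1 \<in> rep_kernel" using row[OF pq] ij by auto
    then show ?thesis using col[of p j i] False pq ij by auto
  qed
qed

text \<open>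
  The element \<open>h a b\<close> moves a joint eigenvector of the \<open>y i\<close> to another one, whose eigenvalue at \<open>b\<close> is
  multiplied by the eigenvalue at \<open>a\<close>, all others being kept. Take a vector of \<open>Q\<close> with as many
  eigenvalues different from 1 as possible. If an eigenvalue \<open>c a\<close> differs from 1 and \<open>c b\<close> does not,
  then \<open>h a b\<close> would increase their number; hence all of them differ from 1. One further application
  of \<open>h a b\<close>, for each \<open>b\<close> with a suitable \<open>a \<noteq> b\<close>, changes exactly the eigenvalue at \<open>b\<close>. The set \<open>Q\<close>
  leaves room for further conditions on the eigenvectors.
\<close>
lemma shear_eigenvectors:
  fixes y :: "'i \<Rightarrow> 'g" and h :: "'i \<Rightarrow> 'i \<Rightarrow> 'g"
  assumes I: "finite I" "2 \<le> card I"
    and y: "\<And>i. i \<in> I \<Longrightarrow> y i \<in> carrier G"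
    and h: "\<And>a b. a \<in> I \<Longrightarrow> b \<in> I \<Longrightarrow> a \<noteq> b \<Longrightarrow> h a b \<in> carrier G"
    and shear: "\<And>a b. a \<in> I \<Longrightarrow> b \<in> I \<Longrightarrow> a \<noteq> b \<Longrightarrow> y b \<otimes> h a b = h a b \<otimes> y b \<otimes> y a"
    and comm: "\<And>a b c. a \<in> I \<Longrightarrow> b \<in> I \<Longrightarrow> c \<in> I \<Longrightarrow> a \<noteq> b \<Longrightarrow> c \<noteq> b \<Longrightarrow> y c \<otimes> h a b = h a b \<otimes> y c"
    and Q: "Q \<subseteq> V - {0}"
    and eig: "\<And>v i. v \<in> Q \<Longrightarrow> i \<in> I \<Longrightarrow> \<exists>c. T (y i) v = c *s v"
    and closed: "\<And>v a b. v \<in> Q \<Longrightarrow> a \<in> I \<Longrightarrow> b \<in> I \<Longrightarrow> a \<noteq> b \<Longrightarrow> T (h a b) v \<in> Q"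
    and v: "v \<in> Q" "a0 \<in> I" "T (y a0) v \<noteq> v"
  obtains w c u d where "w \<in> Q" "\<And>i. i \<in> I \<Longrightarrow> T (y i) w = c i *s w" "\<And>i. i \<in> I \<Longrightarrow> c i \<noteq> 1"
    "\<And>b. b \<in> I \<Longrightarrow> u b \<in> Q" "\<And>b i. b \<in> I \<Longrightarrow> i \<in> I \<Longrightarrow> T (y i) (u b) = d b i *s u b"
    "\<And>b. b \<in> I \<Longrightarrow> d b b \<noteq> c b" "\<And>b i. b \<in> I \<Longrightarrow> i \<in> I \<Longrightarrow> i \<noteq> b \<Longrightarrow> d b i = c i"
proof -
  obtain c where c: "\<And>v i. v \<in> Q \<Longrightarrow> i \<in> I \<Longrightarrow> T (y i) v = c v i *s v" using eig by metis
  have QV: "v \<in> V" "v \<noteq> 0" if "v \<in> Q" for v using that Q by auto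
  have scale_self: "c *s v = d *s v \<longleftrightarrow> c = d" if "v \<in> Q" for c d v using QV[OF that] by simp
  have shift: "T (y i) (T (h a b) v) = (if i = b then c v b * c v a else c v i) *s T (h a b) v"
    if "v \<in> Q" "a \<in> I" "b \<in> I" "a \<noteq> b" "i \<in> I" for v a b i
  proof (cases "i = b")
    case True
    have "T (y b) (T (h a b) v) = T (y b \<otimes> h a b) v"
      using that y h QV by (simp add: T_mult)
    also have "\<dots> = T (h a b) (T (y b) (T (y a) v))"
      using that y h QV by (simp add: T_mult shear)
    finally show ?thesis using that y h True by (simp add: c T_scale mult.commute)
  next
    case False
    have "T (y i) (T (h a b) v) = T (y i \<otimes> h a b) v"
      using that y h QV by (simp add: T_mult)
    also have "\<dots> = T (h a b) (T (y i) v)"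
      using that y h QV False by (simp add: T_mult comm)
    finally show ?thesis using that y h False by (simp add: c T_scale)
  qed
  have shift': "c (T (h a b) v) i = (if i = b then c v b * c v a else c v i)"
    if that: "v \<in> Q" "a \<in> I" "b \<in> I" "a \<noteq> b" "i \<in> I" for v a b i
    using shift[OF that] c[OF closed[OF that(1-4)] that(5)] scale_self[OF closed[OF that(1-4)]]
    by (simp only:)
  define N where "N = (\<lambda>v. card {i \<in> I. c v i \<noteq> 1})"
  define good where "good = (\<lambda>v. v \<in> Q \<and> (\<exists>a\<in>I. c v a \<noteq> 1))"
  have "c v a0 \<noteq> 1" using v c[of v a0] by auto
  then have "good v" using v by (auto simp: good_def)
  moreover have "\<forall>v. good v \<longrightarrow> N v < Suc (card I)"
    unfolding N_def using I(1) by (intro allI impI le_imp_less_Suc card_mono) auto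
  ultimately obtain w where w: "good w" "\<And>v. good v \<Longrightarrow> N v \<le> N w"
    using ex_has_greatest_nat[of good v N] by blast
  obtain a where a: "a \<in> I" "c w a \<noteq> 1" "w \<in> Q" using w(1) by (auto simp: good_def)
  have all: "c w b \<noteq> 1" if b: "b \<in> I" for b
  proof
    assume b1: "c w b = 1"
    then have "a \<noteq> b" using a by auto
    note sh = shift'[OF a(3,1) b this]
    have "good (T (h a b) w)"
      unfolding good_def using closed[OF a(3,1) b \<open>a \<noteq> b\<close>] sh[OF a(1)] a \<open>a \<noteq> b\<close>
      by (intro conjI bexI[of _ a]) simp_all
    moreover have "N w < N (T (h a b) w)" unfolding N_def
    proof (rule psubset_card_mono)
      have "c (T (h a b) w) i \<noteq> 1" if "i \<in> I" "c w i \<noteq> 1" for i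
        using sh[OF that(1)] that(2) b1 by (cases "i = b") simp_all
      moreover have "c (T (h a b) w) b \<noteq> 1" using sh[OF b] b1 a(2) by simp
      ultimately show "{i \<in> I. c w i \<noteq> 1} \<subset> {i \<in> I. c (T (h a b) w) i \<noteq> 1}"
        using b b1 by blast
    qed (use I in simp)
    ultimately show False using w(2)[of "T (h a b) w"] by simp
  qed
  have "\<exists>a. a \<in> I \<and> a \<noteq> b" for b
  proof (rule ccontr)
    assume "\<not> ?thesis"
    then have "I \<subseteq> {b}" by blast
    then have "card I \<le> card {b}" by (intro card_mono) auto
    then show False using I by simp
  qed
  then obtain f where f: "\<And>b. f b \<in> I" "\<And>b. f b \<noteq> b" by metis
  show ?thesis
  proof (rule that[of w "c w" "\<lambda>b. T (h (f b) b) w" "\<lambda>b. c (T (h (f b) b) w)"])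
    show "c (T (h (f b) b) w) b \<noteq> c w b" if b: "b \<in> I" for b
    proof -
      have "c w b \<noteq> 0" using T_eigenvalue_nonzero[OF y[OF b] _ _ c[OF a(3) b]] QV a by blast
      then show ?thesis using shift'[OF a(3) f(1) b f(2) b] all[OF f(1), of b] by simp
    qed
  qed (use a all c f closed shift' in auto)
qed

end

section \<open>Elementary relations in small dimension\<close>

context linear_rep
begin

lemma eigenvector_conj:
  assumes "x \<in> carrier G" "h \<in> carrier G" "z \<in> carrier G" "x \<otimes> h = h \<otimes> z" "v \<in> V" "T z v = c *s v"
  shows "T x (T h v) = c *s T h v"
  using assms T_mult[of x h v] T_mult[of h z v] by (simp add: T_scale)

lemma eigenvector_commute:
  assumes "x \<in> carrier G" "h \<in> carrier G" "x \<otimes> h = h \<otimes> x" "v \<in> V" "T x v = c *s v"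
  shows "T x (T h v) = c *s T h v"
  using assms by (intro eigenvector_conj[where z = x])

lemma T_commute:
  assumes "x \<in> carrier G" "h \<in> carrier G" "x \<otimes> h = h \<otimes> x" "v \<in> V"
  shows "T x (T h v) = T h (T x v)"
  using T_mult[of x h v] T_mult[of h x v] assms by simp

lemma eigenvector_mult:
  assumes "x \<in> carrier G" "y \<in> carrier G" "v \<in> V" "T x v = a *s v" "T y v = b *s v"
  shows "T (x \<otimes> y) v = (b * a) *s v"
  using assms by (simp add: T_mult T_scale)

lemma eigenvector_inv:
  assumes "x \<in> carrier G" "v \<in> V" "v \<noteq> 0" "T x v = a *s v"
  shows "T (inv x) v = inverse a *s v"
proof -
  have "a \<noteq> 0" using T_eigenvalue_nonzero assms by blast
  moreover have "v = a *s T (inv x) v" using T_inv_left[of x v] assms by (simp add: T_scale)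
  ultimately show ?thesis by (metis scale_scale left_inverse scale_one)
qed

lemma not_unipotentE:
  assumes "\<not> unipotent A"
  obtains v c where "v \<in> V" "v \<noteq> 0" "A v = c *s v" "c \<noteq> 1"
  using assms unfolding unipotent_def by blast

end

text \<open>
  The elements \<open>e i j\<close> stand for the elementary matrices with the entry 1; these relations among them
  carry the whole argument, the remaining root elements being reached by \<open>root_elements_in_kernel\<close>.
\<close>
locale elementary_rep = linear_rep +
  fixes e :: "nat \<Rightarrow> nat \<Rightarrow> 'c" and m :: nat
  assumes e_carrier: "i < m \<Longrightarrow> j < m \<Longrightarrow> i \<noteq> j \<Longrightarrow> e i j \<in> carrier G"
    and e_rel: "i < m \<Longrightarrow> j < m \<Longrightarrow> l < m \<Longrightarrow> i \<noteq> j \<Longrightarrow> j \<noteq> l \<Longrightarrow> i \<noteq> l \<Longrightarrow>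
      e i j \<otimes> e j l = e i l \<otimes> e j l \<otimes> e i j"
    and e_comm: "i < m \<Longrightarrow> j < m \<Longrightarrow> k < m \<Longrightarrow> l < m \<Longrightarrow> i \<noteq> j \<Longrightarrow> k \<noteq> l \<Longrightarrow> j \<noteq> k \<Longrightarrow> i \<noteq> l \<Longrightarrow>
      e i j \<otimes> e k l = e k l \<otimes> e i j"
begin

text \<open>
  The row \<open>i\<close> and the shears \<open>e b a\<close>. The index \<open>i\<close>, which does not occur among the columns of the row,
  labels the unmoved vector \<open>w\<close>, so that the \<open>m\<close> eigenvectors are labelled by \<open>{..<m}\<close>.
\<close>
lemma elementary_unipotent:
  assumes nm: "n < m" "3 \<le> m" and i: "i < m" and j: "j < m" "i \<noteq> j"
  shows "unipotent (T (e i j))"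
proof (rule ccontr)
  assume "\<not> unipotent (T (e i j))"
  then obtain v0 c0 where v0: "v0 \<in> V" "v0 \<noteq> 0" "T (e i j) v0 = c0 *s v0" "c0 \<noteq> 1"
    by (rule not_unipotentE)
  define I where "I = {..<m} - {i}"
  have I: "finite I" "card I = m - 1" using i by (auto simp: I_def)
  have ecar: "e i l \<in> carrier G" if "l \<in> I" for l using that i by (intro e_carrier) (auto simp: I_def)
  have hcar: "e b a \<in> carrier G" if "a \<in> I" "b \<in> I" "a \<noteq> b" for a b
    using that by (intro e_carrier) (auto simp: I_def)
  have comm: "e i a \<otimes> e i b = e i b \<otimes> e i a" if "a \<in> I" "b \<in> I" for a b
    using that i by (intro e_comm) (auto simp: I_def)
  have commh: "e i c \<otimes> e b a = e b a \<otimes> e i c" if "a \<in> I" "b \<in> I" "c \<in> I" "a \<noteq> b" "c \<noteq> b" for a b c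
    using that i by (intro e_comm) (auto simp: I_def)
  have shear: "e i b \<otimes> e b a = e b a \<otimes> e i b \<otimes> e i a" if ab: "a \<in> I" "b \<in> I" "a \<noteq> b" for a b
  proof -
    have "e i b \<otimes> e b a = e i a \<otimes> e b a \<otimes> e i b"
      using that i by (intro e_rel) (auto simp: I_def)
    also have "\<dots> = e b a \<otimes> (e i a \<otimes> e i b)"
      using ab ecar hcar by (simp add: commh m_assoc)
    also have "\<dots> = e b a \<otimes> e i b \<otimes> e i a"
      using ab ecar hcar by (simp add: comm[of a b] m_assoc)
    finally show ?thesis .
  qed
  define Q where "Q = {v \<in> V - {0}. \<forall>l\<in>I. \<exists>c. T (e i l) v = c *s v}"
  have jI: "j \<in> I" using j by (simp add: I_def)
  have "\<exists>w\<in>{v \<in> V. T (e i j) v = c0 *s v}. w \<noteq> 0 \<and> (\<exists>c. \<forall>l\<in>I. T (e i l) w = c l *s w)"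
  proof (rule joint_eigenvector_exists)
    show "T (e i a) (T (e i b) w) = T (e i b) (T (e i a) w)"
      if "a \<in> I" "b \<in> I" "w \<in> {v \<in> V. T (e i j) v = c0 *s v}" for a b w
      using that by (intro T_commute comm ecar) auto
    show "T (e i a) w \<in> {v \<in> V. T (e i j) v = c0 *s v}"
      if "a \<in> I" "w \<in> {v \<in> V. T (e i j) v = c0 *s v}" for a w
      using that eigenvector_commute[OF ecar[OF jI] ecar[of a] comm[OF jI]] ecar by auto
  qed (use v0 I T_operator ecar jI eigenspace_subspace in auto)
  then obtain w0 where w0: "w0 \<in> Q" "T (e i j) w0 = c0 *s w0" unfolding Q_def by blast
  then have w0j: "T (e i j) w0 \<noteq> w0"
    using v0(4) scale_right_imp_eq[of w0 c0 1] by (auto simp: Q_def)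
  have closed: "T (e b a) v \<in> Q" if v: "v \<in> Q" and ab: "a \<in> I" "b \<in> I" "a \<noteq> b" for v a b
  proof -
    have vV: "v \<in> V" "v \<noteq> 0" using v by (auto simp: Q_def)
    obtain c where c: "\<And>l. l \<in> I \<Longrightarrow> T (e i l) v = c l *s v" using v unfolding Q_def by (auto simp: Bex_def) metis
    have "\<exists>d. T (e i l) (T (e b a) v) = d *s T (e b a) v" if l: "l \<in> I" for l
    proof (cases "l = b")
      case True
      have "T (e i l) (T (e b a) v) = (c a * c b) *s T (e b a) v"
        unfolding True using shear[OF ab] ab ecar hcar vV
        by (intro eigenvector_conj[where z = "e i b \<otimes> e i a"] eigenvector_mult c) (auto simp: m_assoc)
      then show ?thesis by blast
    next
      case False
      have "T (e i l) (T (e b a) v) = c l *s T (e b a) v"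
        using l commh[OF ab(1,2) l ab(3) False] ab ecar hcar vV
        by (intro eigenvector_conj[where z = "e i l"] c) auto
      then show ?thesis by blast
    qed
    then show ?thesis using vV hcar[OF ab] T_nonzero by (auto simp: Q_def)
  qed
  obtain w c u d where w: "w \<in> Q" "\<And>l. l \<in> I \<Longrightarrow> T (e i l) w = c l *s w"
    and u: "\<And>b. b \<in> I \<Longrightarrow> u b \<in> Q" "\<And>b l. b \<in> I \<Longrightarrow> l \<in> I \<Longrightarrow> T (e i l) (u b) = d b l *s u b"
    and d: "\<And>b. b \<in> I \<Longrightarrow> d b b \<noteq> c b" "\<And>b l. b \<in> I \<Longrightarrow> l \<in> I \<Longrightarrow> l \<noteq> b \<Longrightarrow> d b l = c l"
  proof (rule shear_eigenvectors[of I "e i" "\<lambda>a b. e b a" Q w0 j])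
    show "\<exists>c. T (e i l) v = c *s v" if "v \<in> Q" "l \<in> I" for v l using that by (auto simp: Q_def)
  qed (use I nm ecar hcar shear commh closed w0(1) w0j jI Q_def in auto)
  have "card {..<m} \<le> n"
  proof (rule joint_eigenvectors_card_le[where I = I and A = "\<lambda>l. T (e i l)"
        and v = "\<lambda>t. if t = i then w else u t" and c = "\<lambda>t. if t = i then c else d t"])
    show "\<exists>l\<in>I. (if s = i then c else d s) l \<noteq> (if t = i then c else d t) l"
      if st: "s \<in> {..<m}" "t \<in> {..<m}" "s \<noteq> t" for s t
    proof (cases "s = i")
      case True
      then have "t \<in> I" using st by (simp add: I_def)
      then show ?thesis using d(1)[of t] True st by (intro bexI[of _ t]) auto
    next
      case False
      then have "s \<in> I" using st by (simp add: I_def)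
      then show ?thesis using d(1)[of s] d(2)[of t s] False st by (intro bexI[of _ s]) (auto simp: I_def)
    qed
    show "T (e i l) (if t = i then w else u t) = (if t = i then c else d t) l *s (if t = i then w else u t)"
      if "t \<in> {..<m}" "l \<in> I" for t l
      using that w(2) u(2)[of t l] by (auto simp: I_def)
    show "(if t = i then w else u t) \<in> V" "(if t = i then w else u t) \<noteq> 0" if "t \<in> {..<m}" for t
      using that w(1) u(1)[of t] by (auto simp: I_def Q_def)
  qed (use ecar T_operator in auto)
  then show False using nm by simp
qed

text \<open>
  Adjoin the upper triangular \<open>e i j\<close> row by row from the top. A new element of row \<open>r\<close> commutes with its
  row and multiplies an element \<open>e i r\<close> of an earlier row \<open>i\<close> by one of the same row. The initial part \<open>D\<close>
  is empty for the elementary group and is a commutative normal part for the unitary group.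
\<close>
lemma unipotent_series_rows:
  assumes D: "unipotent_series D"
    and norm: "\<And>d i j. d \<in> D \<Longrightarrow> i < j \<Longrightarrow> j < m \<Longrightarrow> \<exists>c\<in>generate G D. e i j \<otimes> d = c \<otimes> e i j"
    and unip: "\<And>i j. i < j \<Longrightarrow> j < m \<Longrightarrow> unipotent (T (e i j))"
    and r: "r \<le> m"
  shows "unipotent_series (D \<union> {e i j | i j. i < r \<and> i < j \<and> j < m})"
  using r
proof (induction r)
  case (Suc r)
  define E where "E = D \<union> {e i j | i j. i < r \<and> i < j \<and> j < m}"
  have E: "unipotent_series E" using Suc by (simp add: E_def)
  have rm: "r < m" using Suc.prems by simp
  have rows: "unipotent_series (E \<union> e r ` C)" if "finite C" "C \<subseteq> {r<..<m}" for C
    using that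
  proof (induction C rule: finite_induct)
    case (insert c C)
    have c: "r < c" "c < m" using insert.prems by auto
    have gen: "generate G D \<subseteq> generate G (E \<union> e r ` C)" by (intro mono_generate) (auto simp: E_def)
    have inc: "x \<in> generate G (E \<union> e r ` C)" if "x \<in> E \<union> e r ` C" for x using generate.incl[OF that] .
    have "\<exists>g\<in>generate G (E \<union> e r ` C). e r c \<otimes> x = g \<otimes> e r c" if x: "x \<in> E \<union> e r ` C" for x
    proof -
      consider "x \<in> D" | i j where "x = e i j" "i < r" "i < j" "j < m" "j \<noteq> r" | i where "x = e i r" "i < r"
        | b where "x = e r b" "b \<in> C"
        using x by (auto simp: E_def)
      then show ?thesis
      proof cases
        case 1
        then show ?thesis using norm[OF 1 c] gen by blast
      next
        case 2
        then have "e r c \<otimes> x = x \<otimes> e r c" using c by (simp add: e_comm)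
        then show ?thesis using inc[OF x] by blast
      next
        case 3
        have car: "e i r \<in> carrier G" "e r c \<in> carrier G" "e i c \<in> carrier G"
          using c 3 by (auto intro: e_carrier)
        have "e i r \<otimes> e r c = e i c \<otimes> (e r c \<otimes> e i r)"
          using e_rel[of i r c] c 3 car by (simp add: m_assoc)
        then have "e r c \<otimes> e i r = inv (e i c) \<otimes> (e i r \<otimes> e r c)"
          using car by (simp add: m_assoc [symmetric])
        then have "e r c \<otimes> x = (inv (e i c) \<otimes> e i r) \<otimes> e r c"
          using car 3 by (simp add: m_assoc)
        moreover have "e i c \<in> E"
          unfolding E_def using 3 c by (intro UnI2 CollectI exI[of _ i] exI[of _ c]) auto
        then have "inv (e i c) \<otimes> e i r \<in> generate G (E \<union> e r ` C)"
          using generate.inv[of "e i c" "E \<union> e r ` C" G] inc[OF x] 3 by (auto intro: generate.eng)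
        ultimately show ?thesis by blast
      next
        case 4
        then have "e r c \<otimes> x = x \<otimes> e r c" using c insert.prems by (auto intro!: e_comm)
        then show ?thesis using inc[OF x] by blast
      qed
    qed
    then have "unipotent_series (insert (e r c) (E \<union> e r ` C))"
      using insert unip[OF c] c by (intro unipotent_series_insert) (auto intro: e_carrier)
    then show ?case by simp
  qed (use E in simp)
  have "E \<union> e r ` {r<..<m} = D \<union> {e i j | i j. i < Suc r \<and> i < j \<and> j < m}"
  proof -
    have *: "{e i j | i j. i < s \<and> i < j \<and> j < m} = (\<lambda>(i, j). e i j) ` {(i, j). i < s \<and> i < j \<and> j < m}" for s
      by auto
    have "{(i, j). i < Suc r \<and> i < j \<and> j < m} = {(i, j). i < r \<and> i < j \<and> j < m} \<union> Pair r ` {r<..<m}"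
      by (auto simp: less_Suc_eq)
    then show ?thesis by (simp add: E_def * image_Un image_image Un_assoc)
  qed
  then show ?case using rows[of "{r<..<m}"] by simp
qed (use D in simp)

text \<open>
  Starting from \<open>e 0 1\<close>, each commutator with \<open>e j (j + 1)\<close> lowers the flag by one more step.
\<close>
lemma elementary_in_kernel:
  assumes nm: "n < m" "3 \<le> m"
  shows "e 0 (m - 1) \<in> rep_kernel"
proof -
  define D where "D = {e i j | i j. i < m \<and> i < j \<and> j < m}"
  have "unipotent_series ({} \<union> D)"
    unfolding D_def
    by (rule unipotent_series_rows) (use elementary_unipotent[OF nm] unipotent_series_empty in auto)
  then have D: "unipotent_series D" by simp
  have "lowers D (e 0 (Suc j)) (Suc j)" if "Suc j < m" for j
    using that
  proof (induction j)
    case 0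
    have "e 0 1 \<in> D" unfolding D_def using 0 by (intro CollectI exI[of _ 0] exI[of _ 1]) simp
    then show ?case using lowers_one[OF generate.incl] by simp
  next
    case (Suc j)
    have "e (Suc j) (Suc (Suc j)) \<in> D"
      unfolding D_def using Suc.prems by (intro CollectI exI[of _ "Suc j"] exI[of _ "Suc (Suc j)"]) auto
    then have "lowers D (e (Suc j) (Suc (Suc j))) 1" using lowers_one[OF generate.incl] by simp
    from lowers_commutator[OF unipotent_series_carrier[OF D] Suc.IH this, of "e 0 (Suc (Suc j))"]
    show ?case using Suc.prems by (auto simp: e_carrier e_rel)
  qed
  from this[of "m - 2"] have "lowers D (e 0 (m - 1)) (m - 1)"
    using nm by (simp add: numeral_2_eq_2 Suc_diff_Suc)
  then show ?thesis using lowers_imp_kernel[OF D, of _ "m - 1"] nm by simp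
qed

end

section \<open>Hyperbolic relations in small dimension\<close>

text \<open>
  The elements \<open>e i j\<close>, \<open>up i j\<close> and \<open>lo i j\<close> stand for the unitary matrices \<open>\<rho>\<^sub>i\<^sub>j(1)\<close>, \<open>\<rho>\<^sub>i\<^sub>,\<^sub>\<sigma>\<^sub>j(1)\<close> and
  \<open>\<rho>\<^sub>\<sigma>\<^sub>i\<^sub>,\<^sub>j(1)\<close> with \<open>i, j < k\<close> and \<open>i \<noteq> j\<close>. The upper right block of \<open>up i j\<close> is \<open>M - \<epsilon>\<^sup>* M\<^sup>T\<close> for
  \<open>M = E\<^sub>i\<^sub>j\<close>, which makes sense for \<open>i = j\<close> too. Conjugation by \<open>e a b\<close> turns such a block into the one
  for \<open>g M g\<^sup>T\<close> with \<open>g = 1 + E\<^sub>a\<^sub>b\<close>. Expanding \<open>g E\<^sub>i\<^sub>j g\<^sup>T\<close> gives the four relations between \<open>e\<close> and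
  \<open>up\<close>.
\<close>
locale hyperbolic_rep = elementary_rep where m = k for k +
  fixes up lo :: "nat \<Rightarrow> nat \<Rightarrow> 'c"
  assumes up_carrier: "i < k \<Longrightarrow> j < k \<Longrightarrow> up i j \<in> carrier G"
    and lo_carrier: "i < k \<Longrightarrow> j < k \<Longrightarrow> i \<noteq> j \<Longrightarrow> lo i j \<in> carrier G"
    and up_comm: "i < k \<Longrightarrow> j < k \<Longrightarrow> a < k \<Longrightarrow> b < k \<Longrightarrow> up i j \<otimes> up a b = up a b \<otimes> up i j"
    and e_up_comm: "a < k \<Longrightarrow> b < k \<Longrightarrow> i < k \<Longrightarrow> j < k \<Longrightarrow> a \<noteq> b \<Longrightarrow> b \<noteq> i \<Longrightarrow> b \<noteq> j \<Longrightarrow>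
      e a b \<otimes> up i j = up i j \<otimes> e a b"
    and e_up_left: "a < k \<Longrightarrow> b < k \<Longrightarrow> j < k \<Longrightarrow> a \<noteq> b \<Longrightarrow> j \<noteq> b \<Longrightarrow>
      e a b \<otimes> up b j = up b j \<otimes> up a j \<otimes> e a b"
    and e_up_right: "a < k \<Longrightarrow> b < k \<Longrightarrow> i < k \<Longrightarrow> a \<noteq> b \<Longrightarrow> i \<noteq> b \<Longrightarrow>
      e a b \<otimes> up i b = up i b \<otimes> up i a \<otimes> e a b"
    and e_up_diag: "a < k \<Longrightarrow> b < k \<Longrightarrow> a \<noteq> b \<Longrightarrow>
      e a b \<otimes> up b b = up b b \<otimes> up a b \<otimes> up b a \<otimes> up a a \<otimes> e a b"
    and up_lo: "i < k \<Longrightarrow> j < k \<Longrightarrow> l < k \<Longrightarrow> i \<noteq> j \<Longrightarrow> j \<noteq> l \<Longrightarrow> i \<noteq> l \<Longrightarrow>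
      up i l \<otimes> lo l j = e i j \<otimes> lo l j \<otimes> up i l"
    and e_lo_comm: "i < k \<Longrightarrow> j < k \<Longrightarrow> l < k \<Longrightarrow> i \<noteq> j \<Longrightarrow> j \<noteq> l \<Longrightarrow> i \<noteq> l \<Longrightarrow>
      e i j \<otimes> lo l j = lo l j \<otimes> e i j"
    and dim_bounds: "n \<le> k" "3 \<le> k"
begin

text \<open>
  The element \<open>up i i\<close> is the commutator of \<open>e i j\<close> and \<open>up i j\<close> for every \<open>j \<noteq> i\<close>. On its eigenspace for
  \<open>r\<close>, the element \<open>e i j\<close> therefore divides the eigenvalue of \<open>up i j\<close> by \<open>r\<close> and keeps those of the
  other \<open>up i l\<close>. If \<open>r \<noteq> 1\<close>, a joint eigenvector \<open>w\<close>, its images under the \<open>k - 1\<close> elements \<open>e i j\<close>,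
  and the image under two of them have \<open>k + 1\<close> different systems of eigenvalues, too many for \<open>n \<le> k\<close>.
  As labels, \<open>i\<close> stands for \<open>w\<close> and \<open>k\<close> for the double image.
\<close>
lemma up_diag_unipotent:
  assumes i: "i < k"
  shows "unipotent (T (up i i))"
proof (rule ccontr)
  assume "\<not> unipotent (T (up i i))"
  then obtain v0 r where v0: "v0 \<in> V" "v0 \<noteq> 0" "T (up i i) v0 = r *s v0" "r \<noteq> 1"
    by (rule not_unipotentE)
  have r0: "r \<noteq> 0" using T_eigenvalue_nonzero[OF up_carrier[OF i i] v0(1-3)] .
  define I where "I = {..<k} - {i}"
  have I: "l < k" "l \<noteq> i" "i \<noteq> l" if "l \<in> I" for l using that by (auto simp: I_def)
  have ik: "i \<noteq> k" using i by simp
  have memI: "l \<in> I" if "l < k" "l \<noteq> i" for l using that by (simp add: I_def)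
  have finI: "finite I" and cardI: "card I = k - 1" using i by (auto simp: I_def)
  define P where "P = (\<lambda>c w. w \<in> V \<and> w \<noteq> 0 \<and> T (up i i) w = r *s w \<and> (\<forall>l\<in>I. T (up i l) w = c l *s w))"
  note [simp] = i up_carrier e_carrier I
  have "\<exists>w\<in>{v \<in> V. T (up i i) v = r *s v}. w \<noteq> 0 \<and> (\<exists>c. \<forall>l\<in>I. T (up i l) w = c l *s w)"
  proof (rule joint_eigenvector_exists)
    show "T (up i a) (T (up i b) w) = T (up i b) (T (up i a) w)"
      if "a \<in> I" "b \<in> I" "w \<in> {v \<in> V. T (up i i) v = r *s v}" for a b w
      using that by (intro T_commute up_comm) auto
    show "T (up i a) w \<in> {v \<in> V. T (up i i) v = r *s v}"
      if "a \<in> I" "w \<in> {v \<in> V. T (up i i) v = r *s v}" for a w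
      using that eigenvector_commute[OF _ _ up_comm[of i i i a], of w r] by auto
  qed (use v0 T_operator eigenspace_subspace finI in auto)
  then obtain w c where w: "P c w" unfolding P_def by blast
  have shift: "P (c(j := c j / r)) (T (e i j) w)" if w: "P c w" and j: "j \<in> I" for c w j
  proof -
    let ?x = "T (e i j) w"
    have wV: "w \<in> V" "w \<noteq> 0" and s: "T (up i i) w = r *s w" and c: "\<And>l. l \<in> I \<Longrightarrow> T (up i l) w = c l *s w"
      using w by (auto simp: P_def)
    have sx: "T (up i i) ?x = r *s ?x"
      using wV s j by (intro eigenvector_commute e_up_comm [symmetric]) auto
    have "T (up i l) ?x = (c(j := c j / r)) l *s ?x" if l: "l \<in> I" for l
    proof (cases "l = j")
      case True
      have "T (up i j) (T (up i i) ?x) = T (up i j \<otimes> up i i \<otimes> e i j) w"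
        using wV j by (simp add: T_mult)
      also have "\<dots> = T (e i j) (T (up i j) w)"
        using e_up_right[of i j i] wV j by (simp add: T_mult [symmetric])
      finally have "r *s T (up i j) ?x = c j *s ?x" using sx c j by (simp add: T_scale)
      then have "inverse r *s (r *s T (up i j) ?x) = inverse r *s (c j *s ?x)" by simp
      then show ?thesis using r0 True by (simp add: divide_inverse mult.commute)
    next
      case False
      have "T (up i l) ?x = c l *s ?x"
        using False wV c l j by (intro eigenvector_commute e_up_comm [symmetric]) auto
      then show ?thesis using False by simp
    qed
    then show ?thesis using wV sx T_nonzero[of "e i j" w] j by (simp add: P_def)
  qed
  have c0: "c l \<noteq> 0" if "l \<in> I" for l
    using T_eigenvalue_nonzero[of "up i l" w "c l"] w that by (simp add: P_def)
  have cr: "c l / r \<noteq> c l" if "l \<in> I" for l using c0[OF that] v0(4) r0 by (simp add: field_simps)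
  obtain a b where ab: "a \<in> I" "b \<in> I" "a \<noteq> b"
  proof -
    have "\<not> card I \<le> Suc 0" using cardI dim_bounds by simp
    then show ?thesis using card_le_Suc0_iff_eq[OF finI] that by blast
  qed
  define v where "v = (\<lambda>t. if t = i then w else if t = k then T (e i b) (T (e i a) w) else T (e i t) w)"
  define C where "C = (\<lambda>t. if t = i then c else if t = k then c(a := c a / r, b := c b / r) else c(t := c t / r))"
  have P: "P (C t) (v t)" if "t \<in> {..k}" for t
  proof -
    consider "t = i" | "t = k" "t \<noteq> i" | "t \<in> I" "t \<noteq> k"
      using \<open>t \<in> {..k}\<close> memI[of t] by fastforce
    then show ?thesis
    proof cases
      case 2
      then show ?thesis using shift[OF shift[OF w ab(1)] ab(2)] ab(3) by (simp add: C_def v_def)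
    next
      case 3
      then show ?thesis using shift[OF w 3(1)] by (simp add: C_def v_def)
    qed (simp add: w C_def v_def)
  qed
  have "card {..k} \<le> n"
  proof (rule joint_eigenvectors_card_le[where I = I and A = "\<lambda>l. T (up i l)" and v = v and c = C])
    show "\<exists>l\<in>I. C s l \<noteq> C t l" if st: "s \<in> {..k}" "t \<in> {..k}" "s \<noteq> t" for s t
    proof -
      have *: "\<exists>l\<in>I. C s l \<noteq> C t l" if "s = i \<or> (s < k \<and> t = k)" "s \<le> k" "t \<le> k" "s \<noteq> t" for s t
      proof (cases "t = k")
        case True
        obtain l where l: "l \<in> I" "l \<noteq> s" "l = a \<or> l = b" using ab by (metis)
        then have "C t l = c l / r" "C s l = c l"
          using True that ik ab(3) by (auto simp: C_def)
        then show ?thesis using cr l by metis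
      next
        case False
        then have "t \<in> I" using that by (intro memI) auto
        then show ?thesis using cr[of t] that False by (intro bexI[of _ t]) (auto simp: C_def)
      qed
      show ?thesis
      proof (cases "s = i \<or> t = i \<or> s = k \<or> t = k")
        case True
        then show ?thesis using *[of s t] *[of t s] st
          by (metis atMost_iff le_neq_implies_less)
      next
        case False
        then have "s \<in> I" using st by (intro memI) auto
        then show ?thesis using cr[of s] st False by (intro bexI[of _ s]) (auto simp: C_def)
      qed
    qed
  qed (use P T_operator in \<open>auto simp: P_def\<close>)
  then show False using dim_bounds by simp
qed

text \<open>
  On the fixed space of the central element \<open>up i i\<close>, which is the commutator of \<open>e i l\<close> and \<open>up i l\<close>,
  all \<open>up i l\<close> and \<open>e i l\<close> commute. If one of the \<open>up i l\<close> had an eigenvalue other than 1, the shears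
  \<open>inv (e a b)\<close> would produce joint eigenvectors with \<open>k\<close> systems of eigenvalues of the \<open>up i l\<close>. The element \<open>up a b\<close> commutes with these but multiplies the
  eigenvalue of \<open>e i a\<close> by the one of \<open>up i b\<close>, which is not 1. This separates one more vector \<open>z\<close> from
  \<open>w\<close>, and \<open>k + 1\<close> eigenvectors contradict \<open>n \<le> k\<close>.
\<close>
lemma up_unipotent:
  assumes i: "i < k" and a0: "a0 < k" "a0 \<noteq> i"
  shows "unipotent (T (up i a0))"
proof (rule ccontr)
  assume "\<not> unipotent (T (up i a0))"
  then obtain v0 r where v0: "v0 \<in> V" "v0 \<noteq> 0" "T (up i a0) v0 = r *s v0" "r \<noteq> 1"
    by (rule not_unipotentE)
  define I where "I = {..<k} - {i}"
  have I: "l < k" "l \<noteq> i" "i \<noteq> l" if "l \<in> I" for l using that by (auto simp: I_def)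
  have ik: "i \<noteq> k" using i by simp
  have memI: "l \<in> I" if "l < k" "l \<noteq> i" for l using that by (simp add: I_def)
  have a0I: "a0 \<in> I" using a0 by (intro memI)
  have finI: "finite I" and cardI: "card I = k - 1" using i by (auto simp: I_def)
  note [simp] = i up_carrier e_carrier I
  have comm1: "T (e i j) (T (up i l) w) = T (up i l) (T (e i j) w)"
    if w: "w \<in> V" "T (up i i) w = w" and jl: "j \<in> I" "l \<in> I" for j l w
  proof (cases "l = j")
    case True
    have "T (e i j) (T (up i j) w) = T (up i j \<otimes> up i i \<otimes> e i j) w"
      using w jl e_up_right[of i j i] by (simp add: T_mult [symmetric])
    also have "\<dots> = T (up i j) (T (up i i \<otimes> e i j) w)" using w jl by (simp add: T_mult)
    also have "up i i \<otimes> e i j = e i j \<otimes> up i i" using e_up_comm[of i j i i] jl by simp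
    also have "T (up i j) (T (e i j \<otimes> up i i) w) = T (up i j) (T (e i j) w)"
      using w jl by (simp add: T_mult)
    finally show ?thesis using True by simp
  next
    case False
    then show ?thesis
      using w jl e_up_comm[of i j i l] T_mult[of "e i j" "up i l" w] T_mult[of "up i l" "e i j" w] by simp
  qed
  define W where "W = {w \<in> {w \<in> V. T (up i a0) w = r *s w}. T (up i i) w = w}"
  \<comment> \<open>An eigenvector for \<open>r\<close> can be chosen in the fixed space of \<open>up i i\<close>, as the latter is unipotent.\<close>
  have "\<exists>w s. w \<in> {w \<in> V. T (up i a0) w = r *s w} \<and> w \<noteq> 0 \<and> T (up i i) w = s *s w"
  proof (rule eigenvector_exists)
    show "T (up i i) w \<in> {w \<in> V. T (up i a0) w = r *s w}" if "w \<in> {w \<in> V. T (up i a0) w = r *s w}" for w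
      using that a0 eigenvector_commute[OF _ _ up_comm[of i a0 i i], of w r] by auto
  qed (use v0 a0 T_operator eigenspace_subspace in auto)
  then obtain w1 s1 where w1: "w1 \<in> V" "T (up i a0) w1 = r *s w1" "w1 \<noteq> 0" "T (up i i) w1 = s1 *s w1" by blast
  then have "s1 = 1" using up_diag_unipotent[OF i] unfolding unipotent_def by blast
  then have w1W: "w1 \<in> W" using w1 by (simp add: W_def)
  define F where "F = (\<lambda>(l, b). T (if b then up i l else e i l))"
  have Wsub: "subspace W"
  proof -
    have "W = {w \<in> V. T (up i a0) w = r *s w} \<inter> {w \<in> V. T (up i i) w = 1 *s w}" by (auto simp: W_def)
    then show ?thesis using eigenspace_subspace a0 by (simp add: subspace_inter del: scale_one)
  qed
  have "\<exists>w\<in>W. w \<noteq> 0 \<and> (\<exists>c. \<forall>p\<in>I \<times> UNIV. F p w = c p *s w)"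
  proof (rule joint_eigenvector_exists[where v = w1])
    show "operator (F p)" if "p \<in> I \<times> UNIV" for p
      using that T_operator by (auto simp: F_def)
    show "F p (F q w) = F q (F p w)" if "p \<in> I \<times> UNIV" "q \<in> I \<times> UNIV" "w \<in> W" for p q w
    proof -
      obtain l b l' b' where pq: "p = (l, b)" "q = (l', b')" "l \<in> I" "l' \<in> I" using \<open>p \<in> _\<close> \<open>q \<in> _\<close> by auto
      have w: "w \<in> V" "T (up i i) w = w" using \<open>w \<in> W\<close> by (auto simp: W_def)
      have "T (up i l) (T (up i l') w) = T (up i l') (T (up i l) w)"
        using pq w by (intro T_commute up_comm) auto
      moreover have "T (e i l) (T (e i l') w) = T (e i l') (T (e i l) w)"
        using pq w by (intro T_commute e_comm) auto
      ultimately show ?thesis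
        using pq comm1[OF w, of l l'] comm1[OF w, of l' l]
        by (cases b; cases b') (simp_all add: F_def)
    qed
    show "F p w \<in> W" if "p \<in> I \<times> UNIV" "w \<in> W" for p w
    proof -
      obtain l b where p: "p = (l, b)" "l \<in> I" using \<open>p \<in> _\<close> by auto
      have w: "w \<in> V" "T (up i i) w = w" "T (up i a0) w = r *s w" using \<open>w \<in> W\<close> by (auto simp: W_def)
      show ?thesis
      proof (cases b)
        case True
        have "T (up i i) (T (up i l) w) = 1 *s T (up i l) w"
          using p w by (intro eigenvector_commute up_comm) auto
        moreover have "T (up i a0) (T (up i l) w) = r *s T (up i l) w"
          using p w a0 by (intro eigenvector_commute up_comm) auto
        ultimately show ?thesis using True p w by (simp add: F_def W_def)
      next
        case False
        have "T (up i i) (T (e i l) w) = 1 *s T (e i l) w"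
          using p w by (intro eigenvector_commute e_up_comm [symmetric]) auto
        moreover have "T (up i a0) (T (e i l) w) = r *s T (e i l) w"
          using comm1[OF w(1,2) p(2) a0I] w(3) p by (simp add: T_scale)
        ultimately show ?thesis using False p w by (simp add: F_def W_def)
      qed
    qed
  qed (use finI Wsub w1 w1W in \<open>auto simp: W_def\<close>)
  then obtain w0 c0 where w0: "w0 \<in> W" "w0 \<noteq> 0" "\<And>p. p \<in> I \<times> UNIV \<Longrightarrow> F p w0 = c0 p *s w0" by blast
  define Q where "Q = {v \<in> V - {0}. T (up i i) v = v \<and> (\<forall>l\<in>I. \<exists>c. T (up i l) v = c *s v) \<and>
    (\<forall>l\<in>I. \<exists>c. T (e i l) v = c *s v)}"
  have w0Q: "w0 \<in> Q"
    using w0(1,2) w0(3)[of "(_, True)"] w0(3)[of "(_, False)"] by (auto simp: Q_def W_def F_def)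
  have w0a: "T (up i a0) w0 \<noteq> w0"
    using w0(1,2) v0(4) scale_right_imp_eq[of w0 r 1] by (auto simp: W_def)
  define h where "h = (\<lambda>a b. inv (e a b))"
  have hcar: "h a b \<in> carrier G" if "a \<in> I" "b \<in> I" "a \<noteq> b" for a b
    using that by (simp add: h_def)
  have shear: "up i b \<otimes> h a b = h a b \<otimes> up i b \<otimes> up i a" if ab: "a \<in> I" "b \<in> I" "a \<noteq> b" for a b
    using inv_swap[of "up i b \<otimes> up i a" "e a b" "up i b"] e_up_right[of a b i] ab
    by (simp add: h_def m_assoc)
  have commh: "up i c \<otimes> h a b = h a b \<otimes> up i c" if "a \<in> I" "b \<in> I" "c < k" "a \<noteq> b" "c \<noteq> b" for a b c
    using inv_swap[of "up i c" "e a b" "up i c"] e_up_comm[of a b i c] that by (simp add: h_def)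
  have closed: "T (h a b) v \<in> Q" if v: "v \<in> Q" and ab: "a \<in> I" "b \<in> I" "a \<noteq> b" for v a b
  proof -
    have vV: "v \<in> V" "v \<noteq> 0" "T (up i i) v = v" using v by (auto simp: Q_def)
    obtain c d where c: "\<And>l. l \<in> I \<Longrightarrow> T (up i l) v = c l *s v" and d: "\<And>l. l \<in> I \<Longrightarrow> T (e i l) v = d l *s v"
      using v unfolding Q_def mem_Collect_eq by metis
    have "\<exists>s. T (up i l) (T (h a b) v) = s *s T (h a b) v" if l: "l \<in> I" for l
    proof (cases "l = b")
      case True
      have "T (up i l) (T (h a b) v) = (c a * c b) *s T (h a b) v"
        unfolding True using shear[OF ab] ab hcar vV
        by (intro eigenvector_conj[where z = "up i b \<otimes> up i a"] eigenvector_mult c) (auto simp: m_assoc)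
      then show ?thesis by blast
    next
      case False
      have "T (up i l) (T (h a b) v) = c l *s T (h a b) v"
        using l commh[OF ab(1,2) _ ab(3) False] ab hcar vV
        by (intro eigenvector_conj[where z = "up i l"] c) auto
      then show ?thesis by blast
    qed
    moreover have "\<exists>s. T (e i l) (T (h a b) v) = s *s T (h a b) v" if l: "l \<in> I" for l
    proof (cases "l = a")
      case True
      have "e i a \<otimes> e a b = e i b \<otimes> (e a b \<otimes> e i a)" using e_rel[of i a b] ab by (simp add: m_assoc)
      then have "inv (e i b) \<otimes> e i a \<otimes> e a b = e a b \<otimes> e i a"
        using ab by (simp add: m_assoc) (simp add: m_assoc [symmetric])
      then have "e i a \<otimes> h a b = h a b \<otimes> (inv (e i b) \<otimes> e i a)"
        unfolding h_def using ab by (intro inv_swap) auto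
      then have "T (e i l) (T (h a b) v) = (d a * inverse (d b)) *s T (h a b) v"
        unfolding True using ab hcar vV
        by (intro eigenvector_conj[where z = "inv (e i b) \<otimes> e i a"] eigenvector_mult eigenvector_inv d) auto
      then show ?thesis by blast
    next
      case False
      have "e i l \<otimes> h a b = h a b \<otimes> e i l"
        unfolding h_def using ab l False e_comm[of i l a b] by (intro inv_swap) auto
      then have "T (e i l) (T (h a b) v) = d l *s T (h a b) v"
        using l ab hcar vV by (intro eigenvector_conj[where z = "e i l"] d) auto
      then show ?thesis by blast
    qed
    moreover have "T (up i i) (T (h a b) v) = 1 *s T (h a b) v"
      using ab hcar vV by (intro eigenvector_commute commh) auto
    ultimately show ?thesis using vV hcar[OF ab] T_nonzero by (auto simp: Q_def)
  qed
  obtain w c u d where w: "w \<in> Q" "\<And>l. l \<in> I \<Longrightarrow> T (up i l) w = c l *s w" "\<And>l. l \<in> I \<Longrightarrow> c l \<noteq> 1"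
    and u: "\<And>b. b \<in> I \<Longrightarrow> u b \<in> Q" "\<And>b l. b \<in> I \<Longrightarrow> l \<in> I \<Longrightarrow> T (up i l) (u b) = d b l *s u b"
    and d: "\<And>b. b \<in> I \<Longrightarrow> d b b \<noteq> c b" "\<And>b l. b \<in> I \<Longrightarrow> l \<in> I \<Longrightarrow> l \<noteq> b \<Longrightarrow> d b l = c l"
  proof (rule shear_eigenvectors[of I "up i" h Q w0 a0])
    show "\<exists>c. T (up i l) v = c *s v" if "v \<in> Q" "l \<in> I" for v l using that by (auto simp: Q_def)
    show "2 \<le> card I" using cardI dim_bounds by simp
    show "up i c \<otimes> h a b = h a b \<otimes> up i c" if "a \<in> I" "b \<in> I" "c \<in> I" "a \<noteq> b" "c \<noteq> b" for a b c
      using that by (intro commh) auto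
  qed (use finI hcar shear closed w0Q w0a a0I Q_def in auto)
  obtain a b where ab: "a \<in> I" "b \<in> I" "a \<noteq> b"
  proof -
    have "\<not> card I \<le> Suc 0" using cardI dim_bounds by simp
    then show ?thesis using card_le_Suc0_iff_eq[OF finI] that by blast
  qed
  have "\<exists>c. T (e i a) v = c *s v" if "v \<in> Q" for v using that ab(1) by (simp add: Q_def)
  then obtain \<xi> where \<xi>: "\<And>v. v \<in> Q \<Longrightarrow> T (e i a) v = \<xi> v *s v" by metis
  have wV: "w \<in> V" "w \<noteq> 0" using w(1) by (auto simp: Q_def)
  have \<xi>0: "\<xi> w \<noteq> 0" using T_eigenvalue_nonzero[OF _ wV \<xi>[OF w(1)]] ab by simp
  define z where "z = T (up a b) w"
  have zV: "z \<in> V" "z \<noteq> 0" using wV T_nonzero[of "up a b" w] ab by (auto simp: z_def)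
  have z1: "T (up i l) z = c l *s z" if "l \<in> I" for l
    unfolding z_def using w that ab wV by (intro eigenvector_commute up_comm) auto
  have z2: "T (e i a) z = (\<xi> w * c b) *s z"
    unfolding z_def
  proof (rule eigenvector_conj[where z = "up i b \<otimes> e i a"])
    show "T (up i b \<otimes> e i a) w = (\<xi> w * c b) *s w"
      using ab wV by (intro eigenvector_mult w \<xi>) auto
  qed (use ab e_up_left[of i a b] wV in \<open>auto simp: m_assoc\<close>)
  define v where "v = (\<lambda>t. if t = i then w else if t = k then z else u t)"
  \<comment> \<open>Label \<open>i\<close> is \<open>w\<close> and label \<open>k\<close> is \<open>z\<close>; coordinate \<open>i\<close> of a system holds the eigenvalue of \<open>e i a\<close>.\<close>
  define C where "C = (\<lambda>t s. if s = i then (if t = k then \<xi> w * c b else \<xi> (v t))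
    else if t = i \<or> t = k then c s else d t s)"
  have vQ: "v t \<in> Q" if "t < k" for t
    using that w(1) u(1)[OF memI[of t]] by (auto simp: v_def)
  have "card {..k} \<le> n"
  proof (rule joint_eigenvectors_card_le[where I = "{..<k}"
        and A = "\<lambda>l. if l = i then T (e i a) else T (up i l)" and v = v and c = C])
    show "operator (if l = i then T (e i a) else T (up i l))" if "l \<in> {..<k}" for l
      using that ab T_operator by auto
    show "v t \<in> V" "v t \<noteq> 0" if "t \<in> {..k}" for t
      using that vQ[of t] zV i by (cases "t = k"; auto simp: Q_def v_def)+
    show "(if l = i then T (e i a) else T (up i l)) (v t) = C t l *s v t"
      if tl: "t \<in> {..k}" "l \<in> {..<k}" for t l
    proof (cases "t = k")
      case True
      then show ?thesis using z1[OF memI[of l]] z2 tl ik by (auto simp: v_def C_def)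
    next
      case False
      then have "t < k" using tl by simp
      then show ?thesis using \<xi>[OF vQ] w(2)[OF memI[of l]] u(2)[OF memI[of t] memI[of l]] tl False
        by (auto simp: v_def C_def)
    qed
    show "\<exists>l\<in>{..<k}. C s l \<noteq> C t l" if st: "s \<in> {..k}" "t \<in> {..k}" "s \<noteq> t" for s t
    proof (cases "s \<in> I \<or> t \<in> I")
      case True
      have *: "\<exists>l\<in>{..<k}. C s l \<noteq> C t l" if "s \<in> I" "t \<le> k" "s \<noteq> t" for s t
      proof (rule bexI[of _ s])
        have "s \<noteq> i" "s \<noteq> k" using I[OF that(1)] by simp_all
        then have "C s s = d s s" by (simp add: C_def)
        moreover have "C t s = c s" using that d(2)[OF memI[of t], of s] \<open>s \<noteq> i\<close> by (auto simp: C_def)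
        ultimately show "C s s \<noteq> C t s" using d(1) that by metis
      qed (use that in simp)
      from True show ?thesis using *[of s t] *[of t s] st by (metis atMost_iff)
    next
      case False
      then have "(s = i \<and> t = k) \<or> (s = k \<and> t = i)"
        using st memI[of s] memI[of t] by (metis atMost_iff le_neq_implies_less)
      moreover have "\<xi> w * c b \<noteq> \<xi> w" using \<xi>0 w(3)[OF ab(2)] by simp
      ultimately show ?thesis using ik by (intro bexI[of _ i]) (auto simp: C_def v_def)
    qed
  qed simp
  then show False using dim_bounds by simp
qed

lemma third_index:
  assumes "i < k" "j < k" obtains l where "l < k" "l \<noteq> i" "l \<noteq> j"
proof -
  have "card {i, j} < card {..<k}" using dim_bounds by (intro order.strict_trans1[OF card_insert_le_m1[of 2]]) auto
  then have "\<not> {..<k} \<subseteq> {i, j}" using card_mono[of "{i, j}" "{..<k}"] by auto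
  then show ?thesis using that by auto
qed

text \<open>
  Here a lower element enters: \<open>e i j\<close> is the commutator of \<open>up i l\<close> and \<open>lo l j\<close> and commutes with both.
\<close>
lemma e_unipotent:
  assumes "i < k" "j < k" "i \<noteq> j"
  shows "unipotent (T (e i j))"
proof -
  obtain l where l: "l < k" "l \<noteq> i" "l \<noteq> j" using third_index assms by blast
  show ?thesis
    by (rule unipotent_commutator[of "up i l" "lo l j"])
      (use assms l up_lo e_lo_comm e_up_comm up_unipotent up_carrier lo_carrier e_carrier in auto)
qed

lemma unipotent_series_commuting:
  assumes "finite D" "D \<subseteq> carrier G" "\<And>x. x \<in> D \<Longrightarrow> unipotent (T x)"
    "\<And>x y. x \<in> D \<Longrightarrow> y \<in> D \<Longrightarrow> x \<otimes> y = y \<otimes> x"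
  shows "unipotent_series D"
  using assms
proof (induction D rule: finite_induct)
  case (insert y D)
  then show ?case
    by (intro unipotent_series_insert) (auto intro!: bexI[OF _ generate.incl])
qed (rule unipotent_series_empty)

text \<open>
  Along the flag of the group generated by all \<open>up i j\<close> and the upper triangular \<open>e i j\<close>, the element
  \<open>up (k - 2) (k - 1)\<close> lowers by 1. Commutators with \<open>e i (i + 1)\<close> lead up to \<open>up 0 (k - 1)\<close>, which lowers by
  \<open>k - 1\<close>. The commutator with \<open>e (k - 2) (k - 1)\<close> moves the second index instead, and gives the last step
  to \<open>k \<ge> n\<close>.
\<close>
lemma up_in_kernel: "up 0 (k - 2) \<in> rep_kernel"
proof -
  define N where "N = {up i j | i j. i < k \<and> j < k}"
  define D where "D = N \<union> {e i j | i j. i < k \<and> i < j \<and> j < k}"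
  have N: "unipotent_series N"
  proof (rule unipotent_series_commuting)
    have "N = (\<lambda>(i, j). up i j) ` ({..<k} \<times> {..<k})" by (auto simp: N_def)
    then show "finite N" by simp
    show "unipotent (T x)" if "x \<in> N" for x
      using that up_unipotent up_diag_unipotent by (force simp: N_def)
    show "x \<otimes> y = y \<otimes> x" if "x \<in> N" "y \<in> N" for x y
      using that by (auto simp: N_def intro: up_comm)
  qed (auto simp: N_def up_carrier)
  have inN: "up i j \<in> generate G N" if "i < k" "j < k" for i j
    using that by (intro generate.incl) (auto simp: N_def)
  have D: "unipotent_series D"
    unfolding D_def
  proof (rule unipotent_series_rows[OF N])
    fix d a b assume d: "d \<in> N" and ab: "a < b" "b < k"
    then obtain i j where ij: "d = up i j" "i < k" "j < k" by (auto simp: N_def)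
    have a: "a < k" "a \<noteq> b" using ab by auto
    consider "i \<noteq> b" "j \<noteq> b" | "i = b" "j \<noteq> b" | "i \<noteq> b" "j = b" | "i = b" "j = b" by blast
    then show "\<exists>c\<in>generate G N. e a b \<otimes> d = c \<otimes> e a b"
    proof cases
      case 1
      then show ?thesis using ij a ab inN e_up_comm[of a b i j] by (intro bexI[of _ d]) auto
    next
      case 2
      then show ?thesis using ij a ab inN e_up_left[of a b j]
        by (intro bexI[of _ "up b j \<otimes> up a j"]) (auto intro!: generate.eng inN)
    next
      case 3
      then show ?thesis using ij a ab inN e_up_right[of a b i]
        by (intro bexI[of _ "up i b \<otimes> up i a"]) (auto intro!: generate.eng inN)
    next
      case 4
      then show ?thesis using ij a ab inN e_up_diag[of a b]
        by (intro bexI[of _ "up b b \<otimes> up a b \<otimes> up b a \<otimes> up a a"]) (auto intro!: generate.eng inN)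
    qed
  qed (use e_unipotent in auto)
  have eD: "lowers D (e i j) 1" if "i < j" "j < k" for i j
    unfolding D_def using that
    by (intro lowers_one generate.incl UnI2 CollectI exI[of _ i] exI[of _ j]) auto
  note DC = unipotent_series_carrier[OF D]
  have "lowers D (up (k - 1 - Suc s) (k - 1)) (Suc s)" if "Suc s < k" for s
    using that
  proof (induction s)
    case 0
    have "up (k - 1 - Suc 0) (k - 1) \<in> D"
      unfolding D_def N_def using 0
      by (intro UnI1 CollectI exI[of _ "k - 1 - Suc 0"] exI[of _ "k - 1"]) auto
    then show ?case using lowers_one[OF generate.incl] by simp
  next
    case (Suc s)
    let ?i = "k - 1 - Suc (Suc s)"
    have i: "Suc ?i = k - 1 - Suc s" "Suc ?i < k - 1" "?i < k" using Suc.prems by auto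
    have "lowers D (up ?i (k - 1)) (1 + Suc s)"
    proof (rule lowers_commutator[OF DC])
      show "lowers D (e ?i (Suc ?i)) 1" using i by (intro eD) auto
      show "lowers D (up (Suc ?i) (k - 1)) (Suc s)" using Suc i(1) by simp
      show "e ?i (Suc ?i) \<otimes> up (Suc ?i) (k - 1) = up ?i (k - 1) \<otimes> up (Suc ?i) (k - 1) \<otimes> e ?i (Suc ?i)"
        using e_up_left[of ?i "Suc ?i" "k - 1"] up_comm[of "Suc ?i" "k - 1" ?i "k - 1"] i by simp
    qed (use i up_carrier in auto)
    then show ?case by simp
  qed
  from this[of "k - 2"] have "lowers D (up 0 (k - 1)) (k - 1)"
    using dim_bounds by (simp add: numeral_2_eq_2 Suc_diff_Suc)
  moreover have "lowers D (e (k - 2) (k - 1)) 1" using dim_bounds by (intro eD) auto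
  ultimately have "lowers D (up 0 (k - 2)) (1 + (k - 1))"
    using dim_bounds e_up_right[of "k - 2" "k - 1" 0] up_comm[of 0 "k - 1" 0 "k - 2"] up_carrier
    by (intro lowers_commutator[OF DC, of "e (k - 2) (k - 1)" _ "up 0 (k - 1)"]) auto
  then show ?thesis using lowers_imp_kernel[OF D] dim_bounds by simp
qed

end

section \<open>The groups of matrices and their trivial representations\<close>

definition coord_scale :: "'k :: field \<Rightarrow> (nat \<Rightarrow> 'k) \<Rightarrow> nat \<Rightarrow> 'k" where
  "coord_scale c f = (\<lambda>i. c * f i)"

interpretation coord: vector_space coord_scale
  by standard (auto simp: coord_scale_def fun_eq_iff algebra_simps)

definition coord_space :: "nat \<Rightarrow> (nat \<Rightarrow> 'k :: field) set" where
  "coord_space n = {f. \<forall>i\<ge>n. f i = 0}"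

definition mat_act :: "nat \<Rightarrow> 'k :: field mat \<Rightarrow> (nat \<Rightarrow> 'k) \<Rightarrow> nat \<Rightarrow> 'k" where
  "mat_act n A f = (\<lambda>p. if p < n then \<Sum>q<n. A $$ (p, q) * f q else 0)"

lemma bounded_space_coord_space:
  "bounded_space coord_scale (coord_space n :: (nat \<Rightarrow> 'k :: alg_closed_field) set) n"
proof unfold_locales
  show "coord.subspace (coord_space n :: (nat \<Rightarrow> 'k) set)"
    by (auto simp: coord.subspace_def coord_space_def coord_scale_def)
  define \<delta> :: "nat \<Rightarrow> nat \<Rightarrow> 'k" where "\<delta> = (\<lambda>i p. if p = i then 1 else 0)"
  have "f \<in> coord.span (\<delta> ` {..<n})" if f: "f \<in> coord_space n" for f
  proof -
    have sum_apply: "(\<Sum>i\<in>A. g i) x = (\<Sum>i\<in>A. g i x)" for A :: "nat set" and g :: "nat \<Rightarrow> nat \<Rightarrow> 'k" and x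
      by (induction A rule: infinite_finite_induct) auto
    have "f = (\<Sum>i<n. coord_scale (f i) (\<delta> i))"
      using f by (auto simp: fun_eq_iff sum_apply coord_scale_def \<delta>_def coord_space_def if_distrib sum.delta cong: if_cong)
    moreover have "(\<Sum>i<n. coord_scale (f i) (\<delta> i)) \<in> coord.span (\<delta> ` {..<n})"
      by (intro coord.span_sum coord.span_scale coord.span_base) auto
    ultimately show ?thesis by simp
  qed
  then show "\<exists>B. finite B \<and> card B \<le> n \<and> (coord_space n :: (nat \<Rightarrow> 'k) set) \<subseteq> coord.span B"
    by (intro exI[of _ "\<delta> ` {..<n}"]) (auto intro: card_image_le[of "{..<n}" \<delta>, simplified])
qed

lemma mat_act_mult:
  assumes "A \<in> carrier_mat n n" "B \<in> carrier_mat n n"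
  shows "mat_act n (A * B) f = mat_act n A (mat_act n B f)"
proof (rule ext)
  fix p
  show "mat_act n (A * B) f p = mat_act n A (mat_act n B f) p"
  proof (cases "p < n")
    case True
    have "(\<Sum>q<n. (A * B) $$ (p, q) * f q) = (\<Sum>q<n. \<Sum>r<n. A $$ (p, r) * (B $$ (r, q) * f q))"
      using True assms by (intro sum.cong refl)
        (auto simp: scalar_prod_def atLeast0LessThan sum_distrib_right mult.assoc)
    also have "\<dots> = (\<Sum>r<n. A $$ (p, r) * (\<Sum>q<n. B $$ (r, q) * f q))"
      by (subst sum.swap) (simp add: sum_distrib_left)
    finally show ?thesis using True by (simp add: mat_act_def)
  qed (simp add: mat_act_def)
qed

lemma mat_act_one: "f \<in> coord_space n \<Longrightarrow> mat_act n (1\<^sub>m n) f = f"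
  by (auto simp: mat_act_def coord_space_def fun_eq_iff if_distrib[of "\<lambda>x. x * _"] sum.delta cong: if_cong)

lemma mat_act_eq_one:
  assumes "A \<in> carrier_mat n n" "\<And>f. f \<in> coord_space n \<Longrightarrow> mat_act n A f = f"
  shows "A = 1\<^sub>m n"
proof (rule eq_matI)
  fix p q assume pq: "p < dim_row (1\<^sub>m n :: 'a mat)" "q < dim_col (1\<^sub>m n :: 'a mat)"
  define f :: "nat \<Rightarrow> 'a" where "f = (\<lambda>i. if i = q then 1 else 0)"
  have "mat_act n A f p = f p" using assms(2)[of f] pq by (simp add: coord_space_def f_def)
  then show "A $$ (p, q) = 1\<^sub>m n $$ (p, q)"
    using pq by (simp add: mat_act_def f_def if_distrib cong: if_cong)
qed (use assms in auto)

lemma monoid_mat_mult_monoid: "Group.monoid (mat_mult_monoid m :: 'a :: {ring, monoid_mult} mat monoid)"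
proof (rule monoidI)
  have one: "1\<^sub>m m * A = A" "A * 1\<^sub>m m = A" if "A \<in> carrier_mat m m" for A :: "'a mat"
    using that by (auto intro!: eq_matI simp: scalar_prod_def if_distrib[of "\<lambda>x. x * _"] if_distrib[of "\<lambda>x. _ * x"]
        atLeast0LessThan cong: if_cong)
  show "\<one>\<^bsub>mat_mult_monoid m\<^esub> \<otimes>\<^bsub>mat_mult_monoid m\<^esub> A = A" "A \<otimes>\<^bsub>mat_mult_monoid m\<^esub> \<one>\<^bsub>mat_mult_monoid m\<^esub> = A"
    if "A \<in> carrier (mat_mult_monoid m)" for A :: "'a mat"
    using that by (auto simp: mat_mult_monoid_def one)
qed (auto simp: mat_mult_monoid_def)

lemma group_GL: "group (GL m :: 'a :: {ring, monoid_mult} mat monoid)"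
  unfolding GL_def by (rule monoid.units_group[OF monoid_mat_mult_monoid])

lemma GL_simps [simp]:
  "A \<otimes>\<^bsub>GL m\<^esub> B = A * B" "\<one>\<^bsub>GL m\<^esub> = 1\<^sub>m m"
  by (simp_all add: GL_def units_of_def mat_mult_monoid_def)

lemma GL_carrier_mat: "A \<in> carrier (GL m) \<Longrightarrow> A \<in> carrier_mat m m"
  by (auto simp: GL_def units_of_def mat_mult_monoid_def Units_def)

lemma linear_rep_of_hom:
  fixes \<rho> :: "'g \<Rightarrow> 'k :: alg_closed_field mat"
  assumes "group G" and \<rho>: "\<rho> \<in> hom G (GL n)"
  shows "linear_rep coord_scale (coord_space n) n G (\<lambda>g. mat_act n (\<rho> g))"
proof -
  interpret group G by fact
  interpret bounded_space coord_scale "coord_space n :: (nat \<Rightarrow> 'k) set" n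
    by (rule bounded_space_coord_space)
  interpret \<rho>: group_hom G "GL n" \<rho>
    using \<rho> group_GL by (simp add: group_hom_def group_hom_axioms_def group_axioms)
  have car: "\<rho> g \<in> carrier_mat n n" if "g \<in> carrier G" for g
    using that by (intro GL_carrier_mat) simp
  show ?thesis
  proof unfold_locales
    show "operator (mat_act n (\<rho> g))" if "g \<in> carrier G" for g
      unfolding operator_def
      by (auto simp: mat_act_def coord_scale_def coord_space_def fun_eq_iff algebra_simps
          sum.distrib sum_distrib_left)
    show "mat_act n (\<rho> (g \<otimes>\<^bsub>G\<^esub> h)) v = mat_act n (\<rho> g) (mat_act n (\<rho> h) v)"
      if "g \<in> carrier G" "h \<in> carrier G" for g h v
      using that \<rho>.hom_mult[OF that] by (simp add: mat_act_mult car)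
    show "mat_act n (\<rho> \<one>\<^bsub>G\<^esub>) v = v" if "v \<in> coord_space n" for v
      using that \<rho>.hom_one by (simp add: mat_act_one)
  qed
qed

text \<open>
  Matrices of the form \<open>1 + A\<close> are handled through the array \<open>A\<close> of entries. Arrays indexed by \<open>nat \<times> nat\<close>
  form an abelian group as a type, so the relations between root elements reduce to bilinearity of
  \<open>matrix_conv\<close> and its values on matrix units, and sums need no dimension conditions.
\<close>
definition matrix_entry :: "nat \<Rightarrow> nat \<Rightarrow> 'r \<Rightarrow> nat \<times> nat \<Rightarrow> 'r :: {ring, monoid_mult}" where
  "matrix_entry i j a = (\<lambda>p. if p = (i, j) then a else 0)"

definition matrix_conv :: "nat \<Rightarrow> (nat \<times> nat \<Rightarrow> 'r) \<Rightarrow> (nat \<times> nat \<Rightarrow> 'r) \<Rightarrow> nat \<times> nat \<Rightarrow> 'r :: {ring, monoid_mult}" where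
  "matrix_conv N A B = (\<lambda>(p, q). \<Sum>r<N. A (p, r) * B (r, q))"

definition one_plus :: "nat \<Rightarrow> (nat \<times> nat \<Rightarrow> 'r) \<Rightarrow> 'r :: {ring, monoid_mult} mat" where
  "one_plus N A = mat N N (\<lambda>(p, q). (if p = q then 1 else 0) + A (p, q))"

lemma one_plus_mult: "one_plus N A * one_plus N B = one_plus N (A + B + matrix_conv N A B)"
proof (rule eq_matI)
  fix p q assume "p < dim_row (one_plus N (A + B + matrix_conv N A B))"
    "q < dim_col (one_plus N (A + B + matrix_conv N A B))"
  then have pq: "p < N" "q < N" by (auto simp: one_plus_def)
  have "(one_plus N A * one_plus N B) $$ (p, q) =
      (\<Sum>r<N. ((if p = r then 1 else 0) + A (p, r)) * ((if r = q then 1 else 0) + B (r, q)))"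
    using pq by (simp add: one_plus_def scalar_prod_def atLeast0LessThan)
  also have "\<dots> = (\<Sum>r<N. (if p = r then (if r = q then 1 else 0) + B (r, q) else 0) +
      (if r = q then A (p, r) else 0) + A (p, r) * B (r, q))"
    by (intro sum.cong refl) (simp add: algebra_simps)
  also have "\<dots> = one_plus N (A + B + matrix_conv N A B) $$ (p, q)"
    using pq by (simp add: sum.distrib one_plus_def matrix_conv_def algebra_simps)
  finally show "(one_plus N A * one_plus N B) $$ (p, q) = one_plus N (A + B + matrix_conv N A B) $$ (p, q)" .
qed (auto simp: one_plus_def)

lemma matrix_conv_distrib [simp]:
  "matrix_conv N (A + B) C = matrix_conv N A C + matrix_conv N B C"
  "matrix_conv N C (A + B) = matrix_conv N C A + matrix_conv N C B"
  "matrix_conv N (A - B) C = matrix_conv N A C - matrix_conv N B C"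
  "matrix_conv N C (A - B) = matrix_conv N C A - matrix_conv N C B"
  "matrix_conv N (- A) C = - matrix_conv N A C"
  "matrix_conv N C (- A) = - matrix_conv N C A"
  "matrix_conv N 0 C = 0"
  "matrix_conv N C 0 = 0"
  by (auto simp: matrix_conv_def fun_eq_iff algebra_simps sum.distrib sum_subtractf sum_negf)

lemma matrix_conv_entry [simp]:
  assumes "j < N"
  shows "matrix_conv N (matrix_entry i j a) (matrix_entry p q b) = (if j = p then matrix_entry i q (a * b) else 0)"
proof -
  have "(\<Sum>r<N. matrix_entry i j a (x, r) * matrix_entry p q b (r, y)) =
    (\<Sum>r<N. if r = j then matrix_entry i j a (x, j) * matrix_entry p q b (j, y) else 0)" for x y
    by (intro sum.cong) (auto simp: matrix_entry_def)
  then show ?thesis using assms by (auto simp: matrix_conv_def fun_eq_iff) (auto simp: matrix_entry_def)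
qed

lemma matrix_entry_simps [simp]:
  "matrix_entry i j 0 = 0"
  "matrix_entry i j (- a) = - matrix_entry i j a"
  "matrix_entry i j (a + b) = matrix_entry i j a + matrix_entry i j b"
  "matrix_entry i j (a - b) = matrix_entry i j a - matrix_entry i j b"
  by (auto simp: matrix_entry_def fun_eq_iff)

lemma one_plus_in_GL:
  assumes "matrix_conv N A A = 0"
  shows "one_plus N A \<in> carrier (GL N)"
proof -
  have "one_plus N 0 = (1\<^sub>m N :: 'a mat)" by (auto simp: one_plus_def intro!: eq_matI)
  then have "one_plus N A * one_plus N (- A) = 1\<^sub>m N" "one_plus N (- A) * one_plus N A = 1\<^sub>m N"
    by (simp_all add: one_plus_mult assms)
  moreover have "one_plus N B \<in> carrier_mat N N" for B :: "nat \<times> nat \<Rightarrow> 'a" by (simp add: one_plus_def)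
  ultimately show ?thesis
    unfolding GL_def units_of_def mat_mult_monoid_def Units_def by auto
qed

lemma one_mat_unit: "1\<^sub>m N + mat_unit N i j a = one_plus N (matrix_entry i j a)"
  by (auto simp: one_plus_def mat_unit_def matrix_entry_def intro!: eq_matI)

lemma elementary_mat_eq: "elementary_mat N i j a = one_plus N (matrix_entry i j a)"
  by (simp add: elementary_mat_def one_mat_unit)

lemma eu_short_eq: "eu_short k i a = one_plus (2 * k) (matrix_entry i (sig k i) a)"
  by (simp add: eu_short_def one_mat_unit)

lemma eu_long_eq:
  "eu_long star eps k i j a = one_plus (2 * k)
     (matrix_entry i j a - matrix_entry (sig k j) (sig k i) (eu_prime star eps k i j a))"
  by (auto simp: eu_long_def one_plus_def mat_unit_def matrix_entry_def intro!: eq_matI)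

lemma generated_subset_kernel:
  fixes S :: "'r :: {ring, monoid_mult} mat set"
  assumes "linear_rep scale V n (subgroup_generated (GL N) S) T"
    and "S \<subseteq> carrier (GL N)" and "S \<subseteq> linear_rep.rep_kernel V (subgroup_generated (GL N) S) T"
  shows "carrier (subgroup_generated (GL N) S) \<subseteq> linear_rep.rep_kernel V (subgroup_generated (GL N) S) T"
proof -
  interpret linear_rep scale V n "subgroup_generated (GL N) S" T by fact
  interpret GL: group "GL N :: 'r mat monoid" by (rule group_GL)
  have "carrier (subgroup_generated (GL N) S) = carrier (subgroup_generated (subgroup_generated (GL N) S) S)"
    by (simp only: GL.subgroup_generated2)
  also have "\<dots> = generate (subgroup_generated (GL N) S) (carrier (subgroup_generated (GL N) S) \<inter> S)"
    by (rule carrier_subgroup_generated)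
  also have "\<dots> \<subseteq> rep_kernel"
    by (rule generate_subgroup_incl[OF _ subgroup_rep_kernel]) (use assms(3) in blast)
  finally show ?thesis .
qed

lemma generator_in_carrier:
  "x \<in> S \<Longrightarrow> x \<in> carrier (GL N) \<Longrightarrow> x \<in> carrier (subgroup_generated (GL N) S)"
  unfolding carrier_subgroup_generated by (rule generate.incl) simp

lemma elementary_group_rep_trivial:
  fixes \<rho> :: "'r :: {ring, monoid_mult} mat \<Rightarrow> 'k :: alg_closed_field mat"
  assumes n: "2 \<le> n" "n < N" and \<rho>: "\<rho> \<in> hom (elementary_group N) (GL n)"
    and g: "g \<in> carrier (elementary_group N)"
  shows "\<rho> g = 1\<^sub>m n"
proof -
  define S where "S = {elementary_mat N i j (r :: 'r) | i j r. i < N \<and> j < N \<and> i \<noteq> j}"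
  have \<Gamma>: "elementary_group N = subgroup_generated (GL N) S" by (simp add: elementary_group_def S_def)
  have S: "S \<subseteq> carrier (GL N)"
    by (auto simp: S_def elementary_mat_eq intro!: one_plus_in_GL)
  have grp: "group (subgroup_generated (GL N) S)" by (rule group.group_subgroup_generated[OF group_GL])
  let ?G = "subgroup_generated (GL N) S"
  have car: "elementary_mat N i j r \<in> carrier ?G" if "i < N" "j < N" "i \<noteq> j" for i j r
    using that S by (intro generator_in_carrier) (auto simp: S_def)
  interpret linear_rep coord_scale "coord_space n :: (nat \<Rightarrow> 'k) set" n ?G "\<lambda>g. mat_act n (\<rho> g)"
    by (rule linear_rep_of_hom[OF grp]) (use \<rho> \<Gamma> in simp)
  interpret elementary_rep coord_scale "coord_space n :: (nat \<Rightarrow> 'k) set" n ?G "\<lambda>g. mat_act n (\<rho> g)"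
    "\<lambda>i j. elementary_mat N i j 1" N
    by unfold_locales
      (auto intro: car[unfolded elementary_mat_eq] simp: elementary_mat_eq one_plus_mult algebra_simps)
  have "elementary_mat N 0 (N - 1) 1 \<in> rep_kernel" using n by (intro elementary_in_kernel) auto
  then have "elementary_mat N i j r \<in> rep_kernel" if "i < N" "j < N" "i \<noteq> j" for i j r
  proof (rule root_elements_in_kernel[of "{..<N}" "\<lambda>i. i" "elementary_mat N" 0 "N - 1" i j r, rotated 6])
    show "\<exists>l\<in>{..<N}. l \<noteq> i \<and> l \<noteq> j" for i j
      using n by (intro bexI[of _ "if i \<noteq> 0 \<and> j \<noteq> 0 then 0 else if i \<noteq> 1 \<and> j \<noteq> 1 then 1 else 2"]) auto
  qed (use that n in \<open>auto simp: car elementary_mat_eq[symmetric]\<close>, simp add: elementary_mat_eq one_plus_mult algebra_simps)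
  then have "S \<subseteq> rep_kernel" by (auto simp: S_def)
  then have "g \<in> rep_kernel"
    using generated_subset_kernel[OF linear_rep_axioms S] g \<Gamma> by auto
  then show ?thesis
    using \<rho> g \<Gamma> by (intro mat_act_eq_one) (auto simp: rep_kernel_def hom_def intro!: GL_carrier_mat)
qed

lemma sig_simps [simp]:
  "l < 2 * k \<Longrightarrow> sig k l < 2 * k" "l < 2 * k \<Longrightarrow> sig k (sig k l) = l"
  by (auto simp: sig_def)

lemma sig_neq: "l < 2 * k \<Longrightarrow> sig k l \<noteq> l" "l < 2 * k \<Longrightarrow> l \<noteq> sig k l"
  by (auto simp: sig_def)

text \<open>A representative below \<open>k\<close> of the pair consisting of \<open>l\<close> and \<open>\<sigma> l\<close>.\<close>
definition sig_class :: "nat \<Rightarrow> nat \<Rightarrow> nat" where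
  "sig_class k l = (if l < k then l else l - k)"

lemma sig_class_neqD:
  assumes "i < 2 * k" "j < 2 * k" "sig_class k i \<noteq> sig_class k j"
  shows "i \<noteq> j" "j \<noteq> i" "i \<noteq> sig k j" "sig k j \<noteq> i" "sig k i \<noteq> j" "j \<noteq> sig k i"
    "sig k i \<noteq> sig k j" "sig k j \<noteq> sig k i"
  using assms by (auto simp: sig_def sig_class_def split: if_splits)

context form_ring
begin

lemma star_zero [simp]: "star 0 = 0"
  using star_add[of 0 0] by simp

lemma star_uminus [simp]: "star (- x) = - star x"
  using star_add[of x "- x"] by (simp add: eq_neg_iff_add_eq_0 add.commute)

lemma star_diff [simp]: "star (x - y) = star x - star y"
  using star_add[of x "- y"] by simp

lemma star_one [simp]: "star 1 = 1"
proof -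
  obtain y where y: "star y = 1" using star_bij by (metis bij_pointE)
  have "star 1 * star y = star y" using star_mult[of y 1] by simp
  then show ?thesis by (simp add: y)
qed

lemma eps_cancel [simp]: "eps * star eps = 1" "star eps * eps = 1"
  "eps * (star eps * x) = x" "star eps * (eps * x) = x"
  using eps_unit by (simp_all add: mult.assoc [symmetric])

lemma star_star_eps [simp]: "star (star eps) = eps"
  by (simp add: star_star mult.assoc)

text \<open>This compatibility is what makes the second entries in \<open>eu_long_commutator\<close> match.\<close>
lemma eu_prime_mult:
  "eu_prime star eps k i l (a * b) = eu_prime star eps k j l b * eu_prime star eps k i j a"
  by (auto simp: eu_prime_def star_mult mult.assoc)

lemma eu_long_in_GL:
  assumes "i < 2 * k" "j < 2 * k" "i \<noteq> j" "j \<noteq> sig k i"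
  shows "eu_long star eps k i j a \<in> carrier (GL (2 * k))"
proof -
  have "sig_class k i \<noteq> sig_class k j"
    using assms by (auto simp: sig_class_def sig_def split: if_splits)
  note neq = sig_class_neqD[OF assms(1,2) this]
  show ?thesis
    unfolding eu_long_eq using assms neq sig_simps(2)[of j k] by (intro one_plus_in_GL) (auto simp: sig_def split: if_splits)
qed

lemma eu_short_in_GL: "i < 2 * k \<Longrightarrow> eu_short k i a \<in> carrier (GL (2 * k))"
  unfolding eu_short_eq by (intro one_plus_in_GL) (auto simp: sig_def split: if_splits)

lemma eu_long_commutator:
  assumes "i < 2 * k" "j < 2 * k" "l < 2 * k"
    and "sig_class k i \<noteq> sig_class k j" "sig_class k j \<noteq> sig_class k l" "sig_class k i \<noteq> sig_class k l"
  shows "eu_long star eps k i j a * eu_long star eps k j l b =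
    eu_long star eps k i l (a * b) * eu_long star eps k j l b * eu_long star eps k i j a"
proof -
  note sig_ne = sig_neq[OF assms(1)] sig_neq[OF assms(2)] sig_neq[OF assms(3)]
  note neq = sig_class_neqD[OF assms(1,2,4)] sig_class_neqD[OF assms(2,3,5)] sig_class_neqD[OF assms(1,3,6)]
  show ?thesis
    by (simp add: eu_long_eq one_plus_mult neq sig_ne assms(1-3) eu_prime_mult[of k i l a b j])
      (simp add: algebra_simps)
qed

text \<open>
  The symmetry \<open>b = - (star b * eps)\<close> of the elements of \<open>\<Lambda>\<close> makes the two mixed entries of the conjugate
  of a short root element into one long root element.
\<close>
lemma eu_long_short:
  assumes ij: "(i < k \<and> j < k) \<or> (k \<le> i \<and> i < 2 * k \<and> k \<le> j \<and> j < 2 * k)" "i \<noteq> j"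
    and b: "j < k \<Longrightarrow> star b \<in> Lam" "k \<le> j \<Longrightarrow> b \<in> Lam"
  shows "eu_long star eps k i j 1 * eu_short k j b =
    eu_short k j b * eu_long star eps k i (sig k j) b * eu_short k i b * eu_long star eps k i j 1"
proof -
  have lt: "i < 2 * k" "j < 2 * k" using ij by auto
  have cls: "sig_class k i \<noteq> sig_class k j" using ij by (auto simp: sig_class_def)
  note sig_ne = sig_neq[OF lt(1)] sig_neq[OF lt(2)]
  note neq = sig_class_neqD[OF lt cls]
  have one: "eu_prime star eps k i j 1 = 1" using ij by (auto simp: eu_prime_def)
  have prime: "eu_prime star eps k i (sig k j) b = - b"
  proof (cases "j < k")
    case True
    have "star b = - (star (star b) * eps)" using b(1)[OF True] Lam_upper by blast
    then have "star b = - (eps * b)" by (simp add: star_star mult.assoc)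
    then have "star eps * star b = - b" by simp
    then show ?thesis using True ij by (auto simp: eu_prime_def sig_def)
  next
    case False
    then have "b = - (star b * eps)" using b(2) Lam_upper by fastforce
    then have "star b * eps = - b" by (metis add.inverse_inverse)
    then show ?thesis using False ij by (auto simp: eu_prime_def sig_def)
  qed
  show ?thesis
    by (simp add: eu_long_eq eu_short_eq one_plus_mult neq sig_ne lt one prime) (simp add: algebra_simps)
qed

end

text \<open>
  The elements \<open>up i i\<close> are short root elements, because \<open>1 - star eps\<close> has the image \<open>1 - eps\<close> under
  \<open>star\<close>, and \<open>1 - eps\<close> is the element \<open>x - star x * eps\<close> of \<open>\<Lambda>\<close> for \<open>x = 1\<close>. Once all long root elements act
  trivially, \<open>eu_long_short\<close> makes each short root element trivial.
\<close>
lemma unitary_group_rep_trivial: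
  fixes \<rho> :: "'r :: {ring, monoid_mult} mat \<Rightarrow> 'k :: alg_closed_field mat"
  assumes form: "form_ring star eps Lam" and n: "n \<le> k" "3 \<le> k"
    and \<rho>: "\<rho> \<in> hom (unitary_elementary_group star eps Lam k) (GL n)"
    and g: "g \<in> carrier (unitary_elementary_group star eps Lam k)"
  shows "\<rho> g = 1\<^sub>m n"
proof -
  interpret form_ring star eps Lam by fact
  define S where "S = {eu_short k i a | i a. k \<le> i \<and> i < 2 * k \<and> a \<in> Lam}
    \<union> {eu_short k i a | i a. i < k \<and> star a \<in> Lam}
    \<union> {eu_long star eps k i j a | i j a. i < 2 * k \<and> j < 2 * k \<and> i \<noteq> j \<and> j \<noteq> sig k i}"
  have \<Gamma>: "unitary_elementary_group star eps Lam k = subgroup_generated (GL (2 * k)) S"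
    by (simp add: unitary_elementary_group_def S_def)
  have S: "S \<subseteq> carrier (GL (2 * k))"
    by (auto simp: S_def intro: eu_long_in_GL eu_short_in_GL)
  let ?G = "subgroup_generated (GL (2 * k)) S"
  have grp: "group ?G" by (rule group.group_subgroup_generated[OF group_GL])
  have gen: "x \<in> carrier ?G" if "x \<in> S" for x using generator_in_carrier that S by blast
  have long: "eu_long star eps k i j a \<in> carrier ?G" if "i < 2 * k" "j < 2 * k" "i \<noteq> j" "j \<noteq> sig k i" for i j a
    by (rule gen) (use that in \<open>unfold S_def, intro UnI2 CollectI exI[of _ i] exI[of _ j] exI[of _ a], simp\<close>)
  have short: "eu_short k i a \<in> carrier ?G" if "i < 2 * k" "if i < k then star a \<in> Lam else a \<in> Lam" for i a
    using that by (intro gen) (auto simp: S_def split: if_splits)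
  define e where "e = (\<lambda>i j. one_plus (2 * k) (matrix_entry i j (1 :: 'r) - matrix_entry (j + k) (i + k) 1))"
  define up where "up = (\<lambda>i j. one_plus (2 * k) (matrix_entry i (j + k) 1 - matrix_entry j (i + k) (star eps)))"
  define lo where "lo = (\<lambda>i j. one_plus (2 * k) (matrix_entry (i + k) j 1 - matrix_entry (j + k) i eps))"
  have e_eq: "e i j = eu_long star eps k i j 1" if "i < k" "j < k" for i j
    using that by (simp add: e_def eu_long_eq eu_prime_def sig_def)
  have up_eq: "up i j = eu_long star eps k i (j + k) 1" if "i < k" "j < k" for i j
    using that by (simp add: up_def eu_long_eq eu_prime_def sig_def)
  have lo_eq: "lo i j = eu_long star eps k (i + k) j 1" if "i < k" "j < k" for i j
    using that by (simp add: lo_def eu_long_eq eu_prime_def sig_def)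
  have up_diag: "up i i = eu_short k i (1 - star eps)" if "i < k" for i
    using that by (simp add: up_def eu_short_eq sig_def)
  have "1 - eps \<in> Lam" using Lam_lower by (force intro: exI[of _ 1])
  then have up_car: "up i j \<in> carrier ?G" if "i < k" "j < k" for i j
  proof (cases "i = j")
    case True
    then show ?thesis using that \<open>1 - eps \<in> Lam\<close> up_diag[of i] short[of i "1 - star eps"] by simp
  next
    case False
    then show ?thesis using that by (auto simp: up_eq sig_def intro!: long)
  qed
  interpret linear_rep coord_scale "coord_space n :: (nat \<Rightarrow> 'k) set" n ?G "\<lambda>g. mat_act n (\<rho> g)"
    by (rule linear_rep_of_hom[OF grp]) (use \<rho> \<Gamma> in simp)
  interpret hyperbolic_rep coord_scale "coord_space n :: (nat \<Rightarrow> 'k) set" n ?G "\<lambda>g. mat_act n (\<rho> g)" e k up lo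
  proof unfold_locales
    show "e i j \<in> carrier ?G" if "i < k" "j < k" "i \<noteq> j" for i j
      using that by (auto simp: e_eq sig_def intro!: long)
    show "lo i j \<in> carrier ?G" if "i < k" "j < k" "i \<noteq> j" for i j
      using that by (auto simp: lo_eq sig_def intro!: long)
    show "e i j \<otimes>\<^bsub>?G\<^esub> e j l = e i l \<otimes>\<^bsub>?G\<^esub> e j l \<otimes>\<^bsub>?G\<^esub> e i j"
      if "i < k" "j < k" "l < k" "i \<noteq> j" "j \<noteq> l" "i \<noteq> l" for i j l
      using that by (simp add: e_def one_plus_mult) (simp add: algebra_simps)
    show "e i j \<otimes>\<^bsub>?G\<^esub> e l p = e l p \<otimes>\<^bsub>?G\<^esub> e i j"
      if "i < k" "j < k" "l < k" "p < k" "i \<noteq> j" "l \<noteq> p" "j \<noteq> l" "i \<noteq> p" for i j l p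
      using that by (simp add: e_def one_plus_mult) (simp add: algebra_simps)
    show "up i j \<otimes>\<^bsub>?G\<^esub> up a b = up a b \<otimes>\<^bsub>?G\<^esub> up i j"
      if "i < k" "j < k" "a < k" "b < k" for i j a b
      using that by (simp add: up_def one_plus_mult) (simp add: algebra_simps)
    show "e a b \<otimes>\<^bsub>?G\<^esub> up i j = up i j \<otimes>\<^bsub>?G\<^esub> e a b"
      if "a < k" "b < k" "i < k" "j < k" "a \<noteq> b" "b \<noteq> i" "b \<noteq> j" for a b i j
      using that by (simp add: e_def up_def one_plus_mult) (simp add: algebra_simps)
    show "e a b \<otimes>\<^bsub>?G\<^esub> up b j = up b j \<otimes>\<^bsub>?G\<^esub> up a j \<otimes>\<^bsub>?G\<^esub> e a b"
      if "a < k" "b < k" "j < k" "a \<noteq> b" "j \<noteq> b" for a b j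
      using that by (simp add: e_def up_def one_plus_mult) (simp add: algebra_simps)
    show "e a b \<otimes>\<^bsub>?G\<^esub> up i b = up i b \<otimes>\<^bsub>?G\<^esub> up i a \<otimes>\<^bsub>?G\<^esub> e a b"
      if "a < k" "b < k" "i < k" "a \<noteq> b" "i \<noteq> b" for a b i
      using that by (simp add: e_def up_def one_plus_mult) (simp add: algebra_simps)
    show "e a b \<otimes>\<^bsub>?G\<^esub> up b b = up b b \<otimes>\<^bsub>?G\<^esub> up a b \<otimes>\<^bsub>?G\<^esub> up b a \<otimes>\<^bsub>?G\<^esub> up a a \<otimes>\<^bsub>?G\<^esub> e a b"
      if "a < k" "b < k" "a \<noteq> b" for a b
      using that by (simp add: e_def up_def one_plus_mult) (simp add: algebra_simps)
    show "up i l \<otimes>\<^bsub>?G\<^esub> lo l j = e i j \<otimes>\<^bsub>?G\<^esub> lo l j \<otimes>\<^bsub>?G\<^esub> up i l"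
      if "i < k" "j < k" "l < k" "i \<noteq> j" "j \<noteq> l" "i \<noteq> l" for i j l
      using that by (simp add: e_def up_def lo_def one_plus_mult) (simp add: algebra_simps)
    show "e i j \<otimes>\<^bsub>?G\<^esub> lo l j = lo l j \<otimes>\<^bsub>?G\<^esub> e i j"
      if "i < k" "j < k" "l < k" "i \<noteq> j" "j \<noteq> l" "i \<noteq> l" for i j l
      using that by (simp add: e_def lo_def one_plus_mult) (simp add: algebra_simps)
  qed (use n up_car in simp_all)
  have "eu_long star eps k 0 (k - 2 + k) 1 \<in> rep_kernel"
    using up_in_kernel up_eq[of 0 "k - 2"] n by simp
  then have long_kernel: "eu_long star eps k i j a \<in> rep_kernel"
    if "i < 2 * k" "j < 2 * k" "sig_class k i \<noteq> sig_class k j" for i j a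
  proof (rule root_elements_in_kernel[of "{..<2 * k}" "sig_class k" "eu_long star eps k" 0 "k - 2 + k" i j a, rotated 6])
    show "eu_long star eps k i j a \<in> carrier ?G"
      if "i \<in> {..<2 * k}" "j \<in> {..<2 * k}" "sig_class k i \<noteq> sig_class k j" for i j a
      using that sig_class_neqD[of i k j] by (intro long) auto
    show "eu_long star eps k i j a \<otimes>\<^bsub>?G\<^esub> eu_long star eps k j l b =
      eu_long star eps k i l (a * b) \<otimes>\<^bsub>?G\<^esub> eu_long star eps k j l b \<otimes>\<^bsub>?G\<^esub> eu_long star eps k i j a"
      if "i \<in> {..<2 * k}" "j \<in> {..<2 * k}" "l \<in> {..<2 * k}" "sig_class k i \<noteq> sig_class k j"
        "sig_class k j \<noteq> sig_class k l" "sig_class k i \<noteq> sig_class k l" for i j l a b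
      using that eu_long_commutator[of i k j l a b] by simp
    show "\<exists>l\<in>{..<2 * k}. sig_class k l \<noteq> sig_class k i \<and> sig_class k l \<noteq> sig_class k j" for i j
    proof -
      obtain l where "l < 3" "l \<noteq> sig_class k i" "l \<noteq> sig_class k j"
      proof -
        have "card {sig_class k i, sig_class k j} < card {..<3 :: nat}"
          by (rule le_less_trans[OF card_insert_le_m1[of 2]]) auto
        then have "\<not> {..<3} \<subseteq> {sig_class k i, sig_class k j}"
          using card_mono[of "{sig_class k i, sig_class k j}" "{..<3}"] by auto
        then show ?thesis using that by auto
      qed
      then show ?thesis using n by (intro bexI[of _ l]) (auto simp: sig_class_def)
    qed
  qed (use that n in \<open>auto simp: sig_class_def\<close>)
  have short_kernel: "eu_short k i b \<in> rep_kernel" if i: "i < 2 * k" "if i < k then star b \<in> Lam else b \<in> Lam" for i b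
  proof -
    obtain j where j: "j < 2 * k" "j < k \<longleftrightarrow> i < k" "j \<noteq> i"
    proof (cases "i < k")
      case True
      then show ?thesis using that[of "if i = 0 then 1 else 0"] n by auto
    next
      case False
      then show ?thesis using that[of "if i = k then Suc k else k"] n i by auto
    qed
    have cls: "sig_class k i \<noteq> sig_class k j" "sig_class k i \<noteq> sig_class k (sig k j)"
      using i j by (auto simp: sig_class_def sig_def)
    let ?e = "eu_long star eps k i j 1" and ?f = "eu_long star eps k i (sig k j) b"
    let ?s = "eu_short k i b" and ?t = "eu_short k j b"
    have K: "?e \<in> rep_kernel" "?f \<in> rep_kernel" using long_kernel cls i j by simp_all
    then have [simp]: "?e \<in> carrier ?G" "?f \<in> carrier ?G" by (auto simp: rep_kernel_def)
    have st [simp]: "?s \<in> carrier ?G" "?t \<in> carrier ?G" using short i j by auto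
    have rel: "?e \<otimes>\<^bsub>?G\<^esub> ?t = ?t \<otimes>\<^bsub>?G\<^esub> ?f \<otimes>\<^bsub>?G\<^esub> ?s \<otimes>\<^bsub>?G\<^esub> ?e"
      using eu_long_short[of i k j b] i j by (auto split: if_splits)
    have "mat_act n (\<rho> ?s) v = v" if v: "v \<in> coord_space n" for v
    proof -
      have "mat_act n (\<rho> ?t) v = mat_act n (\<rho> (?e \<otimes>\<^bsub>?G\<^esub> ?t)) v"
        using K v T_mult[of ?e ?t v] T_V[of ?t v] by (simp add: rep_kernel_def del: mult_subgroup_generated)
      also have "\<dots> = mat_act n (\<rho> ?t) (mat_act n (\<rho> ?s) v)"
        unfolding rel using K v T_V[of ?s v] by (simp add: T_mult rep_kernel_def del: mult_subgroup_generated)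
      finally have eq: "mat_act n (\<rho> ?t) v = mat_act n (\<rho> ?t) (mat_act n (\<rho> ?s) v)" .
      show ?thesis
        using T_inv_left[OF st(2) v] T_inv_left[OF st(2) T_V[OF st(1) v]] unfolding eq by metis
    qed
    then show ?thesis by (simp add: rep_kernel_def)
  qed
  have "S \<subseteq> rep_kernel"
  proof
    fix x assume "x \<in> S"
    then consider i a where "x = eu_short k i a" "i < 2 * k" "if i < k then star a \<in> Lam else a \<in> Lam"
      | i j a where "x = eu_long star eps k i j a" "i < 2 * k" "j < 2 * k" "i \<noteq> j" "j \<noteq> sig k i"
      unfolding S_def by fastforce
    then show "x \<in> rep_kernel"
    proof cases
      case 2
      then have "sig_class k i \<noteq> sig_class k j" by (auto simp: sig_class_def sig_def split: if_splits)
      then show ?thesis using 2 long_kernel by simp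
    qed (use short_kernel in simp)
  qed
  then have "g \<in> rep_kernel"
    using generated_subset_kernel[OF linear_rep_axioms S] g \<Gamma> by auto
  then show ?thesis
    using \<rho> g \<Gamma> by (intro mat_act_eq_one) (auto simp: rep_kernel_def hom_def intro!: GL_carrier_mat)
qed

text \<open>The line spanned by the first unit vector is invariant and proper.\<close>
lemma trivial_rep_not_irreducible:
  assumes n: "2 \<le> n" and triv: "\<And>g. g \<in> carrier G \<Longrightarrow> \<rho> g = (1\<^sub>m n :: 'k :: field mat)"
  shows "\<not> irreducible_rep G n \<rho>"
proof
  assume irr: "irreducible_rep G n \<rho>"
  define W where "W = {v \<in> carrier_vec n. \<forall>i. 0 < i \<longrightarrow> i < n \<longrightarrow> vec_index v i = (0 :: 'k)}"
  have W_sub: "W \<subseteq> carrier_vec n" unfolding W_def by blast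
  have W_index: "vec_index v i = 0" if "v \<in> W" "0 < i" "i < n" for v i
    using that unfolding W_def by blast
  have WI: "v \<in> W" if "v \<in> carrier_vec n" "\<And>i. 0 < i \<Longrightarrow> i < n \<Longrightarrow> vec_index v i = 0" for v
    using that unfolding W_def by blast
  have W_zero: "0\<^sub>v n \<in> W" by (rule WI) simp_all
  have W_smult: "c \<cdot>\<^sub>v v \<in> W" if "v \<in> W" for c v
  proof (rule WI)
    have v: "v \<in> carrier_vec n" using that W_sub by blast
    then show "c \<cdot>\<^sub>v v \<in> carrier_vec n" by simp
    show "vec_index (c \<cdot>\<^sub>v v) i = 0" if i: "0 < i" "i < n" for i
      using index_smult_vec(1)[of i v c] carrier_vecD[OF v] W_index[OF \<open>v \<in> W\<close> i] i by simp
  qed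
  have W_add: "v + w \<in> W" if "v \<in> W" "w \<in> W" for v w
  proof (rule WI)
    have vw: "v \<in> carrier_vec n" "w \<in> carrier_vec n" using that W_sub by blast+
    then show "v + w \<in> carrier_vec n" by simp
    show "vec_index (v + w) i = 0" if i: "0 < i" "i < n" for i
      using index_add_vec(1)[of i w v] carrier_vecD[OF vw(2)] W_index[OF \<open>v \<in> W\<close> i] W_index[OF \<open>w \<in> W\<close> i] i
      by simp
  qed
  interpret vec_space "TYPE('k)" n .
  have "VectorSpace.subspace class_ring W (module_vec TYPE('k) n)"
  proof -
    have "LinearCombinations.submodule class_ring W V"
    proof (rule submodule.intro[OF module_axioms])
    qed (simp_all only: module_vec_simps W_add W_smult W_zero W_sub)
    then show ?thesis using vectorspace_axioms by (simp add: VectorSpace.subspace_def)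
  qed
  moreover have "\<rho> g *\<^sub>v w \<in> W" if "g \<in> carrier G" "w \<in> W" for g w
    using that(2) W_sub unfolding triv[OF that(1)] by (simp add: subset_iff)
  ultimately have "W = {0\<^sub>v n} \<or> W = carrier_vec n"
    using irr unfolding irreducible_rep_def by blast
  moreover have "unit_vec n 0 \<in> W" "(unit_vec n 0 :: 'k vec) \<noteq> 0\<^sub>v n"
  proof -
    show "unit_vec n 0 \<in> W" using n by (intro WI) auto
    show "(unit_vec n 0 :: 'k vec) \<noteq> 0\<^sub>v n"
    proof
      assume "(unit_vec n 0 :: 'k vec) = 0\<^sub>v n"
      then have "vec_index (unit_vec n 0 :: 'k vec) 0 = vec_index (0\<^sub>v n) 0" by (rule arg_cong)
      then show False using n by simp
    qed
  qed
  moreover have "(unit_vec n 1 :: 'k vec) \<notin> W"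
    using W_index[of "unit_vec n 1" 1] n by auto
  moreover have "(unit_vec n 1 :: 'k vec) \<in> carrier_vec n" by simp
  ultimately show False by blast
qed

text \<open>Extension of scalars to the algebraic closure.\<close>
lemma hom_map_to_ac:
  fixes \<rho> :: "'g \<Rightarrow> 'k :: field mat"
  assumes "\<rho> \<in> hom G (GL n)"
  shows "(\<lambda>g. map_mat to_ac (\<rho> g)) \<in> hom G (GL n :: 'k alg_closure mat monoid)"
proof -
  interpret ac: comm_ring_hom "to_ac :: 'k \<Rightarrow> 'k alg_closure" by standard simp_all
  have mult: "map_mat to_ac (A * B) = map_mat to_ac A * map_mat to_ac B"
    if "A \<in> carrier_mat n n" "B \<in> carrier_mat n n" for A B :: "'k mat"
    by (rule ac.mat_hom_mult[OF that])
  have "map_mat to_ac A \<in> carrier (GL n)" if A: "A \<in> carrier (GL n)" for A :: "'k mat"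
  proof -
    obtain B where B: "A \<in> carrier_mat n n" "B \<in> carrier_mat n n" "A * B = 1\<^sub>m n" "B * A = 1\<^sub>m n"
      using A by (auto simp: GL_def units_of_def Units_def mat_mult_monoid_def)
    then have "map_mat to_ac A * map_mat to_ac B = 1\<^sub>m n" "map_mat to_ac B * map_mat to_ac A = 1\<^sub>m n"
      by (simp_all add: mult [symmetric] ac.mat_hom_one)
    then show ?thesis
      using B(1,2) by (auto simp: GL_def units_of_def Units_def mat_mult_monoid_def)
  qed
  then show ?thesis using assms mult by (auto simp: hom_def GL_carrier_mat Pi_iff)
qed

lemma low_dimensional_rep_trivial:
  fixes \<rho> :: "'r :: {ring, monoid_mult} mat \<Rightarrow> 'k :: alg_closed_field mat"
  assumes "2 \<le> n"
    and \<Gamma>: "(\<exists>k \<ge> n. \<Gamma> = elementary_group (k + 1)) \<or>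
      (\<exists>k star eps Lam. k \<ge> max n 3 \<and> form_ring star eps Lam \<and>
        \<Gamma> = unitary_elementary_group star eps Lam k)"
    and \<rho>: "\<rho> \<in> reps \<Gamma> n" and g: "g \<in> carrier \<Gamma>"
  shows "\<rho> g = 1\<^sub>m n"
  using \<Gamma>
proof (elim disjE exE conjE)
  fix k assume "n \<le> k" "\<Gamma> = elementary_group (k + 1)"
  then show ?thesis
    using elementary_group_rep_trivial[of n "k + 1" \<rho> g] assms(1) \<rho> g by (simp add: reps_def)
next
  fix k star eps Lam
  assume "max n 3 \<le> k" "form_ring star eps Lam" "\<Gamma> = unitary_elementary_group star eps Lam k"
  then show ?thesis
    using unitary_group_rep_trivial[of star eps Lam n k \<rho> g] \<rho> g by (simp add: reps_def)
qed

lemma eigenvalue_one_mat: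
  assumes "eigenvalue (1\<^sub>m n :: 'k :: field mat) x"
  shows "x = 1"
proof -
  obtain v where v: "v \<in> carrier_vec n" "v \<noteq> 0\<^sub>v n" "v = x \<cdot>\<^sub>v v"
    using assms unfolding eigenvalue_def eigenvector_def by auto
  obtain i where i: "i < n" "vec_index v i \<noteq> 0"
  proof (rule ccontr)
    assume "\<not> thesis"
    then have "v = 0\<^sub>v n" using that v(1) by (intro eq_vecI) auto
    then show False using v(2) by simp
  qed
  have "vec_index v i = x * vec_index v i"
    using arg_cong[OF v(3), of "\<lambda>w. vec_index w i"] index_smult_vec(1)[of i v x] carrier_vecD[OF v(1)] i(1)
    by simp
  then show ?thesis using i(2) by simp
qed

theorem corollary2:
  fixes n :: nat and \<Gamma> :: "'r :: {ring, monoid_mult} mat monoid"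
  assumes "fin_gen_ring TYPE('r)"
    and "n \<ge> 2"
    and "(\<exists>k \<ge> n. \<Gamma> = elementary_group (k + 1)) \<or>
         (\<exists>k star eps Lam. k \<ge> max n 3 \<and> form_ring star eps Lam \<and>
            \<Gamma> = unitary_elementary_group star eps Lam k \<and> fin_gen_group \<Gamma>)"
  shows "(\<forall>\<rho> :: 'r mat \<Rightarrow> 'k :: field mat. \<rho> \<in> reps \<Gamma> n \<longrightarrow>
            (\<forall>A \<in> \<rho> ` carrier \<Gamma>. \<forall>x :: 'k alg_closure. eigenvalue (map_mat to_ac A) x \<longrightarrow>
               algebraic_int x \<and>
               (CHAR('k) = 0 \<longrightarrow>
                  (\<exists>p :: int poly. Polynomial.lead_coeff p = 1 \<and> poly (map_poly of_int p) x = 0)) \<and>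
               (CHAR('k) > 0 \<longrightarrow> (\<exists>m > 0. x ^ m = 1))))
       \<and> finite ({\<rho> :: 'r mat \<Rightarrow> 'l :: alg_closed_field mat. irreducible_rep \<Gamma> n \<rho>}
                   // conj_irreducible_reps \<Gamma> n)"
proof (intro conjI allI impI ballI)
  have \<Gamma>: "(\<exists>k \<ge> n. \<Gamma> = elementary_group (k + 1)) \<or>
      (\<exists>k star eps Lam. k \<ge> max n 3 \<and> form_ring star eps Lam \<and>
        \<Gamma> = unitary_elementary_group star eps Lam k)"
    using assms(3) by blast
  {
    fix \<rho> :: "'r mat \<Rightarrow> 'k mat" and A and x :: "'k alg_closure"
    assume \<rho>: "\<rho> \<in> reps \<Gamma> n" and "A \<in> \<rho> ` carrier \<Gamma>" and x: "eigenvalue (map_mat to_ac A) x"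
    then obtain g where g: "g \<in> carrier \<Gamma>" "A = \<rho> g" by blast
    have "(\<lambda>g. map_mat to_ac (\<rho> g)) \<in> reps \<Gamma> n"
      using hom_map_to_ac \<rho> unfolding reps_def by blast
    from low_dimensional_rep_trivial[OF assms(2) \<Gamma> this g(1)]
    have "map_mat to_ac A = 1\<^sub>m n" by (simp add: g(2))
    with x have one: "x = 1" using eigenvalue_one_mat[of n x] by simp
    show "algebraic_int x" by (simp add: one)
    show "\<exists>p :: int poly. Polynomial.lead_coeff p = 1 \<and> poly (map_poly of_int p) x = 0"
      by (intro exI[of _ "[:- 1, 1:]"]) (simp add: one map_poly_pCons)
    show "\<exists>m > 0. x ^ m = 1" by (intro exI[of _ 1]) (simp add: one)
  }
  have "\<not> irreducible_rep \<Gamma> n \<rho>" for \<rho> :: "'r mat \<Rightarrow> 'l mat"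
  proof
    assume irr: "irreducible_rep \<Gamma> n \<rho>"
    then have "\<rho> \<in> reps \<Gamma> n" by (simp add: irreducible_rep_def)
    then have "\<rho> g = 1\<^sub>m n" if "g \<in> carrier \<Gamma>" for g
      using low_dimensional_rep_trivial[OF assms(2) \<Gamma> _ that] by blast
    then show False using trivial_rep_not_irreducible[OF assms(2)] irr by blast
  qed
  then have "{\<rho> :: 'r mat \<Rightarrow> 'l mat. irreducible_rep \<Gamma> n \<rho>} = {}" by blast
  then show "finite ({\<rho> :: 'r mat \<Rightarrow> 'l mat. irreducible_rep \<Gamma> n \<rho>} // conj_irreducible_reps \<Gamma> n)"
    by simp
qed

end
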